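(* Let $n,m\ge 0$ with $n+m>0$, let $N\ge 1$, and let $V=V_0\oplus V_1$ with $V_0=V_1=\mathbb{C}^N$. Let $\widetilde{\mathcal{L}}_{n,m}$ be the bidegree-$(n,m)$ component of the free Lie superalgebra on $V$, regarded as a $\mathrm{GL}(\mathbb{C}^N)$-module via the diagonal embedding $\mathrm{GL}(\mathbb{C}^N)\hookrightarrow \mathrm{GL}(\mathbb{C}^N)\oplus\mathrm{GL}(\mathbb{C}^N)$. Then its character is \[ \operatorname{ch}(\widetilde{\mathcal{L}}_{n,m};x_1,\dots,x_N)=\frac{1}{n+m}\sum_{d\mid \gcd(n,m)} (-1)^{m+\frac{m}{d}}\mu(d)\binom{\frac{n+m}{d}}{\frac{m}{d}}\, p_d(x_1,\dots,x_N)^{\frac{n+m}{d}}, \] where $\mu$ is the Möbius function and $p_d(x_1,\dots,x_N)=x_1^d+\cdots+x_N^d$.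
   Context: A super vector space $V=V_0\oplus V_1$ has tensor superalgebra $\widetilde{T}(V)=\bigoplus_{d\ge0}(V_0\oplus V_1)^{\otimes d}$ with concatenation product; it is bigraded, $\widetilde{T}_{n,m}(V)$ being spanned by tensors with $n$ factors from $V_0$ and $m$ factors from $V_1$, and $\mathbb{Z}/2$-graded by the parity of $m$. The super commutator is $[x,y]=xy-(-1)^{|x||y|}yx$ for homogeneous $x,y$ of parities $|x|,|y|$, extended bilinearly. The free Lie superalgebra $\widetilde{\mathcal{L}}(V)\subseteq\widetilde{T}(V)$ is the span of all iterated super commutators of elements of $V$ (equivalently the Lie sub-superalgebra generated by $V$); $\widetilde{\mathcal{L}}_{n,m}=\widetilde{\mathcal{L}}(V)\cap \widetilde{T}_{n,m}(V)$ is spanned by iterated bracketings with $n$ entries from $V_0$ and $m$ from $V_1$. $\mathrm{GL}(V_0)\oplus\mathrm{GL}(V_1)$ acts naturally. The character of a $\mathrm{GL}(\mathbb{C}^N)$-module is the trace of $\mathrm{diag}(x_1,\dots,x_N)$. *)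

theory Defs
  imports Complex_Main "HOL-Library.Function_Algebras" "HOL-Computational_Algebra.Computational_Algebra"
begin

text \<open>Model of the tensor superalgebra of V = V0 (+) V1 with V0 = V1 = C^N.
  A basis letter is (p, i): parity p (False = even, i.e. from V0; True = odd, from V1)
  and index i in {1..N}.  A tensor is a complex-valued function on words (letter lists);
  the word [a1,...,ad] stands for the basis tensor a1 (x) ... (x) ad.\<close>

type_synonym letter = "bool \<times> nat"
type_synonym tensor = "letter list \<Rightarrow> complex"

definition cscale :: "complex \<Rightarrow> tensor \<Rightarrow> tensor" where
  "cscale c f = (\<lambda>w. c * f w)"

interpretation tvs: vector_space cscale
  by unfold_locales (auto simp: cscale_def fun_eq_iff algebra_simps)

definition tmult :: "tensor \<Rightarrow> tensor \<Rightarrow> tensor" where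
  "tmult s t = (\<lambda>w. \<Sum>k\<in>{0..length w}. s (take k w) * t (drop k w))"

definition sbracket :: "bool \<Rightarrow> tensor \<Rightarrow> bool \<Rightarrow> tensor \<Rightarrow> tensor" where
  "sbracket p x q y = tmult x y - cscale ((-1) ^ (if p \<and> q then 1 else 0)) (tmult y x)"

definition Vpart :: "nat \<Rightarrow> bool \<Rightarrow> tensor set" where
  "Vpart N p = {f. \<forall>w. f w \<noteq> 0 \<longrightarrow> (\<exists>i\<in>{1..N}. w = [(p, i)])}"

datatype 'a btree = Leaf 'a | Node "'a btree" "'a btree"

fun leaves :: "'a btree \<Rightarrow> 'a list" where
  "leaves (Leaf a) = [a]"
| "leaves (Node s t) = leaves s @ leaves t"

definition tpar :: "(bool \<times> tensor) btree \<Rightarrow> bool" where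
  "tpar t = odd (length (filter fst (leaves t)))"

fun beval :: "(bool \<times> tensor) btree \<Rightarrow> tensor" where
  "beval (Leaf a) = snd a"
| "beval (Node s t) = sbracket (tpar s) (beval s) (tpar t) (beval t)"

definition freeLie :: "nat \<Rightarrow> nat \<Rightarrow> nat \<Rightarrow> tensor set" where
  "freeLie N n m = tvs.span
     {beval t | t. (\<forall>(p, v)\<in>set (leaves t). v \<in> Vpart N p)
                 \<and> length (filter (\<lambda>a. \<not> fst a) (leaves t)) = n
                 \<and> length (filter fst (leaves t)) = m}"

text \<open>Action of diag(x_1,...,x_N) in GL(C^N), diagonally on V0 and V1, extended to tensors.\<close>
definition diag_act :: "(nat \<Rightarrow> complex) \<Rightarrow> tensor \<Rightarrow> tensor" where
  "diag_act x f = (\<lambda>w. (\<Prod>a\<leftarrow>w. x (snd a)) * f w)"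

definition trace_on :: "tensor set \<Rightarrow> (tensor \<Rightarrow> tensor) \<Rightarrow> complex" where
  "trace_on W f = (THE tr. \<exists>B a. finite B \<and> B \<subseteq> W \<and> tvs.independent B \<and> tvs.span B = W
       \<and> (\<forall>b\<in>B. f b = (\<Sum>c\<in>B. cscale (a b c) c)) \<and> tr = (\<Sum>b\<in>B. a b b))"

definition character :: "nat \<Rightarrow> nat \<Rightarrow> nat \<Rightarrow> (nat \<Rightarrow> complex) \<Rightarrow> complex" where
  "character N n m x = trace_on (freeLie N n m) (diag_act x)"

definition moebius :: "nat \<Rightarrow> int" where
  "moebius d = (if d = 0 then 0 else if squarefree d then (-1) ^ card (prime_factors d) else 0)"

definition power_sum :: "nat \<Rightarrow> nat \<Rightarrow> (nat \<Rightarrow> complex) \<Rightarrow> complex" where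
  "power_sum N d x = (\<Sum>i\<in>{1..N}. x i ^ d)"

end

theory Submission
  imports Defs "HOL-Library.List_Lexorder" "HOL-Library.Product_Lexorder" "HOL-Library.Sublist"
begin

text \<open>
  Call a word super-Lyndon if it is a Lyndon word, or the square of a Lyndon word with an odd
  number of odd letters. The standard bracketing of a super-Lyndon word w is a nonzero multiple
  of w plus lexicographically larger rearrangements of w, so these brackets are linearly
  independent. Conversely, a Lie element is primitive for the super coproduct, hence orthogonal
  to all signed shuffles of two nonempty words; and a word w that is not super-Lyndon is the
  largest term, with nonzero coefficient, of a shuffle of two factors of w. Hence a Lie element
  vanishing on all super-Lyndon words is zero, so the brackets form a basis, and it consists of
  eigenvectors of the torus. It remains to count Lyndon words by weight: every nonempty word is
  a rotation of a power of a Lyndon word in exactly one way, and Moebius inversion applies. The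
  squares account for the signs.
\<close>

section \<open>Lyndon words and shuffles\<close>

text \<open>The delicate case is a pure power \<open>wpow v j\<close> of a Lyndon word. Shuffling i
  copies of \<open>v\<close> with the other j - i copies produces this power in several ways, and
  for odd \<open>v\<close> the Koszul signs may cancel them: the coefficient is a Gaussian binomial
  at q = -1. For j = 2, i = 1 it is 0, so this shuffle cannot remove the square of an odd Lyndon
  word, in agreement with the nonzero bracket of an odd element with itself. For j > 2 the choice i
  = 2 gives j div 2, which is nonzero, so higher powers are removed. This is why the last Lyndon
  factor is split off with its full multiplicity: if something precedes \<open>wpow v j\<close>, the
  cut there yields the word exactly once and without sign, and only pure powers need the binomial.

  The sign (-1)^(m + m div d) reflects the same squares. It is -1 only for even m and odd m div d,
  which forces d to be even. Either 4 divides d and the Moebius factor vanishes, or d = 2b with b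
  odd, and mu(2b) = -mu(b) turns these terms into the count of Lyndon words in bidegree (n/2, m/2)
  at squared variables.\<close>

abbreviation wpow :: "'a list \<Rightarrow> nat \<Rightarrow> 'a list" where
  "wpow v n \<equiv> concat (replicate n v)"

lemma wpow_add: "wpow v (a + b) = wpow v a @ wpow v b"
  by (simp add: replicate_add)

lemma append_less_cancel [simp]:
  fixes q x y :: "'a::linorder list"
  shows "q @ x < q @ y \<longleftrightarrow> x < y"
  by (induction q) auto

lemma append_le_cancel [simp]:
  fixes q x y :: "'a::linorder list"
  shows "q @ x \<le> q @ y \<longleftrightarrow> x \<le> y"
  by (induction q) auto

lemma le_append [simp]:
  fixes x y :: "'a::linorder list"
  shows "x \<le> x @ y"
  by (induction x) auto

lemma append_less_self [simp]:
  fixes x y :: "'a::linorder list"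
  shows "x < x @ y \<longleftrightarrow> y \<noteq> []"
  using append_less_cancel[of x "[]" y] by (cases y) auto

lemma prefix_imp_le:
  fixes x y :: "'a::linorder list"
  shows "prefix x y \<Longrightarrow> x \<le> y"
  by (auto simp: prefix_def)

lemma append_less_append:
  fixes x y :: "'a::linorder list"
  assumes "x < y" "\<not> prefix x y"
  shows "x @ s < y @ t"
  using assms
proof (induction x arbitrary: y)
  case Nil
  then show ?case by simp
next
  case (Cons a x)
  then show ?case by (cases y) auto
qed

lemma append_less_append_same_length:
  fixes x y :: "'a::linorder list"
  assumes "x < y" "length x = length y"
  shows "x @ s < y @ t"
  using assms append_less_append by (fastforce simp: prefix_def)

definition lyndon :: "'a::linorder list \<Rightarrow> bool" where
  "lyndon l \<longleftrightarrow> l \<noteq> [] \<and> (\<forall>u v. l = u @ v \<longrightarrow> u \<noteq> [] \<longrightarrow> v \<noteq> [] \<longrightarrow> l < v)"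

lemma lyndonD:
  "lyndon (u @ v) \<Longrightarrow> u \<noteq> [] \<Longrightarrow> v \<noteq> [] \<Longrightarrow> u @ v < v"
  by (auto simp: lyndon_def)

lemma lyndon_append_less:
  assumes "lyndon (u @ v)" "u \<noteq> []" "v \<noteq> []"
  shows "(u @ v) @ s < v @ t"
proof (rule append_less_append[OF lyndonD[OF assms]])
  show "\<not> prefix (u @ v) v"
    using assms(2) prefix_length_le by fastforce
qed

section \<open>The largest shuffle of two words\<close>

lemma Cons_in_shuffles_cases:
  assumes "a # z \<in> shuffles x y"
  obtains x' where "x = a # x'" "z \<in> shuffles x' y"
    | y' where "y = a # y'" "z \<in> shuffles x y'"
  using assms by (cases x; cases y) auto

lemma Cons_in_shufflesI:
  "z \<in> shuffles x y \<Longrightarrow> a # z \<in> shuffles (a # x) y"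
  "z \<in> shuffles x y \<Longrightarrow> a # z \<in> shuffles x (a # y)"
  by (cases x; cases y; auto)+

lemma append_shuffles_append:
  assumes "z \<in> shuffles x y" "z' \<in> shuffles x' y'"
  shows "z @ z' \<in> shuffles (x @ x') (y @ y')"
  using assms(1)
proof (induction z arbitrary: x y)
  case Nil
  then show ?case using assms(2) by (simp add: Nil_in_shuffles)
next
  case (Cons a z)
  from Cons.prems show ?case
    by (cases rule: Cons_in_shuffles_cases) (auto intro!: Cons_in_shufflesI Cons.IH)
qed

lemma append_in_shuffles: "x @ y \<in> shuffles x y"
  using append_shuffles_append[of x x "[]" y "[]" y] by simp

text \<open>Handing the prefix \<open>p\<close> from the larger to the smaller word cannot lower the
  largest shuffle: letters read from \<open>p\<close> stay available, and whenever a letter is read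
  from \<open>y\<close>, \<open>x\<close> offers one at least as large.\<close>

lemma shuffle_exchange:
  fixes x y z :: "'a::linorder list"
  assumes "z \<in> shuffles (p @ x) y" "y \<le> x"
  shows "\<exists>z'\<in>shuffles x (p @ y). z \<le> z'"
  using assms
proof (induction z arbitrary: p x y)
  case Nil
  then show ?case by (auto simp: Nil_in_shuffles)
next
  case (Cons e z)
  show ?case
  proof (cases p)
    case Nil
    then show ?thesis using Cons.prems by auto
  next
    case (Cons a p')
    from Cons.prems(1) consider
      "e = a" "z \<in> shuffles (p' @ x) y"
      | y' where "y = e # y'" "z \<in> shuffles (p @ x) y'"
      unfolding Cons_in_shuffles_iff using Cons by (cases y) auto
    then show ?thesis
    proof cases
      case 1
      from Cons.IH[OF 1(2) Cons.prems(2)] obtain z' where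
        "z' \<in> shuffles x (p' @ y)" "z \<le> z'" by blast
      then show ?thesis using 1 Cons
        by (intro bexI[of _ "a # z'"]) (auto simp: Cons_in_shuffles_iff)
    next
      case 2
      from Cons.prems(2) 2 obtain c x' where x: "x = c # x'" by (cases x) auto
      show ?thesis
      proof (cases "e < c")
        case True
        then show ?thesis using x
          by (intro bexI[of _ "c # x' @ p @ y"])
             (auto simp: Cons_in_shuffles_iff append_in_shuffles)
      next
        case False
        with x 2 Cons.prems(2) have ce: "c = e" and le: "y' \<le> x'" by auto
        \<comment> \<open>The letter is now charged to \<open>x\<close> instead of \<open>y\<close>.
          Its copy in \<open>y\<close> joins the end of \<open>p\<close>, so that
          \<open>(p @ [e]) @ y'\<close> is again \<open>p @ y\<close>.\<close>
        from Cons.IH[of "p @ [e]" x' y'] 2 x ce le obtain z' where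
          "z' \<in> shuffles x' ((p @ [e]) @ y')" "z \<le> z'" by auto
        then show ?thesis using x ce 2
          by (intro bexI[of _ "e # z'"]) (auto simp: Cons_in_shuffles_iff)
      qed
    qed
  qed
qed

lemma shuffles_split:
  assumes "z @ z' \<in> shuffles x y"
  obtains x1 x2 y1 y2 where "x = x1 @ x2" "y = y1 @ y2"
    "z \<in> shuffles x1 y1" "z' \<in> shuffles x2 y2"
proof -
  have "\<exists>x1 x2 y1 y2. x = x1 @ x2 \<and> y = y1 @ y2 \<and> z \<in> shuffles x1 y1 \<and> z' \<in> shuffles x2 y2"
    using assms
  proof (induction z arbitrary: x y)
    case Nil
    then show ?case by (intro exI[of _ "[]"] exI[of _ x] exI[of _ y]) auto
  next
    case (Cons a z)
    from Cons.prems consider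
      x' where "x = a # x'" "z @ z' \<in> shuffles x' y"
      | y' where "y = a # y'" "z @ z' \<in> shuffles x y'"
      by (cases x; cases y) (auto simp: Cons_in_shuffles_iff)
    then show ?case
    proof cases
      case 1
      from Cons.IH[OF 1(2)] obtain x1 x2 y1 y2 where
        "x' = x1 @ x2" "y = y1 @ y2" "z \<in> shuffles x1 y1" "z' \<in> shuffles x2 y2" by blast
      then show ?thesis using 1
        by (intro exI[of _ "a # x1"] exI[of _ x2] exI[of _ y1] exI[of _ y2])
           (auto simp: Cons_in_shuffles_iff)
    next
      case 2
      from Cons.IH[OF 2(2)] obtain x1 x2 y1 y2 where
        "x = x1 @ x2" "y' = y1 @ y2" "z \<in> shuffles x1 y1" "z' \<in> shuffles x2 y2" by blast
      then show ?thesis using 2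
        by (intro exI[of _ x1] exI[of _ x2] exI[of _ "a # y1"] exI[of _ y2])
           (auto simp: Cons_in_shuffles_iff)
    qed
  qed
  then show ?thesis using that by blast
qed

text \<open>Equivalently: every nonempty suffix of u exceeds the infinite word v v v ...\<close>

definition above_wpows :: "'a::linorder list \<Rightarrow> 'a list \<Rightarrow> bool" where
  "above_wpows v u \<longleftrightarrow> (\<forall>s n. suffix s u \<longrightarrow> s \<noteq> [] \<longrightarrow> wpow v n < s)"

lemma above_wpows_Cons: "above_wpows v (a # u) \<Longrightarrow> above_wpows v u"
  by (auto simp: above_wpows_def suffix_Cons)

text \<open>Makes the inductions on shuffles close up: after the first letter of a copy of the
  Lyndon word has been read, the rest of that copy takes the place of \<open>u\<close>.\<close>

lemma lyndon_above_wpows: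
  assumes "lyndon (a # v)"
  shows "above_wpows (a # v) v"
  unfolding above_wpows_def
proof (intro allI impI)
  fix s n assume "suffix s v" "s \<noteq> []"
  then obtain t where t: "v = t @ s" by (auto simp: suffix_def)
  show "wpow (a # v) n < s"
  proof (cases n)
    case 0
    then show ?thesis using \<open>s \<noteq> []\<close> by (cases s) auto
  next
    case (Suc k)
    then show ?thesis
      using lyndon_append_less[of "a # t" s "wpow (a # v) k" "[]"] assms t \<open>s \<noteq> []\<close> by simp
  qed
qed

text \<open>Two exponents are needed because the remainder of either power may be left over on its
  own side while letters are read one at a time.\<close>

lemma shuffle_le:
  assumes "lyndon v" "above_wpows v u"
    and "z \<in> shuffles (u @ wpow v i) (wpow v j)"
  shows "z \<le> u @ wpow v (i + j)"
  using assms(2,3)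
\<comment> \<open>Induction on the length and not on the list: the exchange below replaces the tail
  by another word of the same length.\<close>
proof (induction z arbitrary: u i j rule: measure_induct_rule[of length])
  case (less cz)
  show ?case
  proof (cases cz)
    case Nil
    then show ?thesis by simp
  next
    case (Cons c z)
    have IH: "z0 \<le> u @ wpow v (i + j)"
      if "length z0 = length z" "above_wpows v u" "z0 \<in> shuffles (u @ wpow v i) (wpow v j)"
      for z0 u i j
      using less.IH[of z0] that Cons by auto
    note prems = less.prems(1) less.prems(2)[unfolded Cons]
    obtain a0 v' where v: "v = a0 # v'" using assms(1) by (cases v) (auto simp: lyndon_def)
    have above': "above_wpows v v'" using lyndon_above_wpows assms(1) v by blast
    show ?thesis
    proof (cases u)
      case Nil
      \<comment> \<open>With \<open>u\<close> empty both arguments are powers of \<open>v\<close>;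
        by symmetry of the shuffle it is enough to read the first letter from the first one.\<close>
      have first: "c # z \<le> wpow v (i + j)" if mem: "z \<in> shuffles (tl (wpow v i)) (wpow v j)"
        and ne: "wpow v i \<noteq> []" "hd (wpow v i) = c" for i j
      proof -
        obtain i' where i': "i = Suc i'" using ne by (cases i) auto
        have "z \<in> shuffles (v' @ wpow v i') (wpow v j)" using mem i' v by simp
        from IH[OF refl above' this] show ?thesis using i' v ne by simp
      qed
      from prems(2) Nil have "c # z \<in> shuffles (wpow v i) (wpow v j)" by simp
      then have "c # z \<le> wpow v (i + j)"
      proof (cases rule: Cons_in_shuffles_cases)
        case (1 x')
        then show ?thesis using first[of i j] by simp
      next
        case (2 y')
        then show ?thesis using first[of j i] shuffles_commutes[of y' "wpow v i"]
          by (simp add: add.commute)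
      qed
      then show ?thesis using Nil Cons by simp
    next
      case u: (Cons a u')
      from prems(2) u consider
        "c = a" "z \<in> shuffles (u' @ wpow v i) (wpow v j)"
        | y where "wpow v j = c # y" "z \<in> shuffles (u @ wpow v i) y"
        unfolding Cons_in_shuffles_iff by (cases "wpow v j") auto
      then show ?thesis
      proof cases
        case 1
        then show ?thesis using IH[OF refl above_wpows_Cons] prems(1) u Cons by auto
      next
        case 2
        have "c # y < a # u'" using prems(1) u 2 unfolding above_wpows_def
          by (metis suffix_order.refl list.distinct(1))
        then consider "c < a" | "c = a" "y < u'" by auto
        then show ?thesis
        proof cases
          case 1
          then show ?thesis using u Cons by simp
        next
          case c: 2
          have "y \<le> u' @ wpow v i" using c(2) le_append[of u' "wpow v i"] by (simp add: less_le_trans less_imp_le)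
          \<comment> \<open>The letter read from \<open>wpow v j\<close> equals the head of
            \<open>u\<close>, so it may be charged to \<open>u\<close>. The exchange gives
            \<open>a\<close> back to \<open>y\<close>, which restores \<open>wpow v j\<close>, at
            the price of a possibly larger tail.\<close>
          with shuffle_exchange[of z "[a]" "u' @ wpow v i" y] 2 u obtain z' where
            z': "z' \<in> shuffles (u' @ wpow v i) (a # y)" "z \<le> z'" by auto
          have len: "length z' = length z"
            using z'(1) 2 u by (auto dest!: length_shuffles)
          have "z' \<le> u' @ wpow v (i + j)"
            using IH[OF len above_wpows_Cons, of a u' i j] prems(1) u 2 z' c(1) by simp
          then show ?thesis using z'(2) u c(1) Cons by simp
        qed
      qed
    qed
  qed
qed

text \<open>Strictness: the bound is missed as soon as a letter of the power is read before the
  nonempty \<open>u\<close>.\<close>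

lemma shuffle_less:
  assumes "lyndon v" "above_wpows v u" "u \<noteq> []"
    and "wpow v j = c # y" "z \<in> shuffles (u @ wpow v i) y"
  shows "c # z < u @ wpow v (i + j)"
proof -
  have mem: "c # z \<in> shuffles (u @ wpow v i) (wpow v j)"
    using assms(4,5) by (simp add: Cons_in_shufflesI)
  have "c # z \<noteq> u @ wpow v (i + j)"
  proof
    assume eq: "c # z = u @ wpow v (i + j)"
    obtain u' where u: "u = c # u'" using assms(3) eq by (cases u) auto
    then have z: "z = u' @ wpow v (i + j)" using eq by simp
    from shuffles_split[OF assms(5)[unfolded z]] obtain x1 x2 y1 y2 where
      split: "u @ wpow v i = x1 @ x2" "y = y1 @ y2" "u' \<in> shuffles x1 y1" by metis
    have "length x1 < length u" using split(3) u by (auto dest!: length_shuffles)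
    \<comment> \<open>\<open>s\<close> is the part of \<open>u\<close> still unread after
      \<open>length u\<close> letters; it is nonempty because one of these letters was
      \<open>c\<close>.\<close>
    then obtain s where s: "u = x1 @ s" "s \<noteq> []" "x2 = s @ wpow v i"
      using split(1) by (auto simp: append_eq_append_conv2)
    have "u \<in> shuffles x1 (c # y1)" using u split(3) by (simp add: Cons_in_shufflesI)
    \<comment> \<open>The first \<open>length u\<close> letters still spell \<open>u\<close>; the
      unread remainders are now simply concatenated. The bound on this new shuffle makes
      \<open>s\<close> at most a power of \<open>v\<close>, against
      \<open>above_wpows\<close>.\<close>
    from append_shuffles_append[OF this append_in_shuffles[of x2 y2]]
    have "u @ x2 @ y2 \<in> shuffles (u @ wpow v i) (wpow v j)"
      using split assms(4) by simp
    from shuffle_le[OF assms(1,2) this] have "x2 @ y2 \<le> wpow v (i + j)" by simp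
    moreover have "wpow v (i + j) < s"
      using assms(2) s(1,2) unfolding above_wpows_def by (meson suffixI)
    moreover have "s \<le> x2 @ y2" using s(3) le_append[of s "wpow v i @ y2"] by simp
    ultimately show False by simp
  qed
  with shuffle_le[OF assms(1,2) mem] show ?thesis by simp
qed

section \<open>The last Lyndon factor of a word\<close>

lemma smallest_suffix:
  fixes w :: "'a::linorder list"
  assumes "w \<noteq> []"
  obtains v where "suffix v w" "v \<noteq> []" "\<And>s. suffix s w \<Longrightarrow> s \<noteq> [] \<Longrightarrow> v \<le> s"
proof -
  let ?S = "set (suffixes w) - {[]}"
  have fin: "finite ?S" by simp
  have "w \<in> ?S" using assms by (simp add: set_suffixes_eq)
  then have "?S \<noteq> {}" by blast
  from Min_in[OF fin this] Min_le[OF fin] show ?thesis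
    by (intro that[of "Min ?S"]) (auto simp: set_suffixes_eq)
qed

lemma smallest_suffix_lyndon:
  assumes "suffix v w" "v \<noteq> []" "\<And>s. suffix s w \<Longrightarrow> s \<noteq> [] \<Longrightarrow> v \<le> s"
  shows "lyndon v"
  unfolding lyndon_def
proof (intro conjI allI impI)
  fix a b assume v: "v = a @ b" "a \<noteq> []" "b \<noteq> []"
  have "suffix b w" using v(1) assms(1) by (metis suffixI suffix_order.trans)
  then have "v \<le> b" using assms(3) v(3) by blast
  moreover have "v \<noteq> b" using v by auto
  ultimately show "v < b" by simp
qed (fact assms(2))

text \<open>Splits off the last factor v of the Chen-Fox-Lyndon factorization with its full
  multiplicity j; this v is the smallest nonempty suffix.\<close>

lemma lyndon_decomposition:
  fixes w :: "'a::linorder list"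
  assumes "w \<noteq> []"
  obtains u v j where "w = u @ wpow v j" "j > 0" "lyndon v" "above_wpows v u"
proof -
  obtain v where v: "suffix v w" "v \<noteq> []" "\<And>s. suffix s w \<Longrightarrow> s \<noteq> [] \<Longrightarrow> v \<le> s"
    using smallest_suffix[OF assms] by blast
  define P where "P = (\<lambda>j. suffix (wpow v j) w)"
  have bound: "j \<le> length w" if "P j" for j
  proof -
    have "j \<le> j * length v" using v(2) by (cases v) auto
    also have "\<dots> = length (wpow v j)" by (induction j) auto
    also have "\<dots> \<le> length w" using that unfolding P_def by (rule suffix_length_le)
    finally show ?thesis .
  qed
  have "P 1" unfolding P_def using v(1) by simp
  define j where "j = (GREATEST j. P j)"
  have Pj: "P j" unfolding j_def by (rule GreatestI_nat[of P, OF \<open>P 1\<close> bound])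
  have jmax: "i \<le> j" if "P i" for i
    unfolding j_def by (rule Greatest_le_nat[of P, OF that bound])
  obtain u where w: "w = u @ wpow v j" using Pj unfolding P_def suffix_def by blast
  have nsuf: "\<not> suffix v u"
  proof
    assume "suffix v u"
    then obtain u' where "u = u' @ v" by (auto simp: suffix_def)
    then have "P (Suc j)" unfolding P_def w by (auto simp: suffix_def)
    with jmax show False by fastforce
  qed
  \<comment> \<open>Minimality of \<open>v\<close> concerns suffixes of \<open>w\<close>, hence only
    \<open>s @ wpow v j\<close>. If a smaller \<open>s\<close> were a prefix of \<open>v\<close>,
    cancelling it would leave a proper suffix of the Lyndon word \<open>v\<close> that is too
    small.\<close>
  have ge: "v \<le> s" if s: "suffix s u" "s \<noteq> []" for s
  proof (rule ccontr)
    assume "\<not> v \<le> s"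
    then have "s < v" by simp
    have "suffix (s @ wpow v j) w" using s(1) w by (auto simp: suffix_def)
    then have le: "v \<le> s @ wpow v j" using v(3) s(2) by simp
    show False
    proof (cases "prefix s v")
      case False
      from append_less_append[OF \<open>s < v\<close> this, of "wpow v j" "[]"] le show False by simp
    next
      case True
      then obtain t where t: "v = s @ t" by (auto simp: prefix_def)
      have "t \<noteq> []" using \<open>s < v\<close> t by auto
      with smallest_suffix_lyndon[OF v] lyndon_append_less[of s t "wpow v (j - 1)" "[]"] t s(2)
      have "v @ wpow v (j - 1) < t" by simp
      moreover have "wpow v j = v @ wpow v (j - 1)" using jmax[OF \<open>P 1\<close>] by (cases j) auto
      moreover have "t \<le> wpow v j" using le unfolding t by simp
      ultimately show False by simp
    qed
  qed
  \<comment> \<open>Leading copies of \<open>v\<close> are stripped from \<open>s\<close>. They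
    never exhaust it, since \<open>v\<close> is not a suffix of \<open>u\<close> by maximality of
    \<open>j\<close>.\<close>
  have "wpow v n < s" if "suffix s u" "s \<noteq> []" for s n
    using that
  proof (induction n arbitrary: s)
    case 0
    then show ?case by (cases s) auto
  next
    case (Suc n)
    show ?case
    proof (cases "prefix v s")
      case True
      then obtain s' where s': "s = v @ s'" by (auto simp: prefix_def)
      have "suffix s' u" using s' Suc.prems(1) by (metis suffixI suffix_order.trans)
      moreover have "s' \<noteq> []" using s' nsuf Suc.prems(1) by auto
      ultimately have "wpow v n < s'" by (rule Suc.IH)
      then show ?thesis using s' by simp
    next
      case False
      with ge[OF Suc.prems] have "v < s" by (auto simp: less_le)
      from append_less_append[OF this False, of "wpow v n" "[]"] show ?thesis by simp
    qed
  qed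
  then show ?thesis
    using that[OF w] jmax[OF \<open>P 1\<close>] smallest_suffix_lyndon[OF v]
    unfolding above_wpows_def by simp
qed

section \<open>Signed shuffles\<close>

definition opar :: "letter list \<Rightarrow> bool" where
  "opar w = odd (length (filter fst w))"

definition ksign :: "bool \<Rightarrow> bool \<Rightarrow> complex" where
  "ksign p q = (-1) ^ (if p \<and> q then 1 else 0)"

lemma opar_simps [simp]:
  "opar [] = False"
  "opar (a # w) = (fst a \<noteq> opar w)"
  "opar (u @ v) = (opar u \<noteq> opar v)"
  by (auto simp: opar_def)

lemma ksign_simps [simp]:
  "ksign False q = 1" "ksign p False = 1" "ksign True True = -1"
  by (auto simp: ksign_def)

lemma ksign_commute: "ksign p q = ksign q p"
  by (auto simp: ksign_def)

lemma ksign_square [simp]: "ksign p q * ksign p q = 1"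
  by (auto simp: ksign_def)

text \<open>The pairing of a tensor with the signed shuffle of two words; equivalently, a matrix
  entry of the cocommutative coproduct of the tensor superalgebra.\<close>

fun sh :: "letter list \<Rightarrow> letter list \<Rightarrow> tensor \<Rightarrow> complex" where
  "sh [] v g = g v"
| "sh (a # u) [] g = g (a # u)"
| "sh (a # u) (b # v) g = sh u (b # v) (\<lambda>z. g (a # z))
     + ksign (fst b) (opar (a # u)) * sh (a # u) v (\<lambda>z. g (b # z))"

lemma sh_Nil_right [simp]: "sh u [] g = g u"
  by (cases u) auto

lemma sh_eq_0: "(\<And>z. z \<in> shuffles u v \<Longrightarrow> g z = 0) \<Longrightarrow> sh u v g = 0"
  by (induction u v g rule: sh.induct) (auto simp: Cons_in_shuffles_iff)

lemma sh_add: "sh u v (\<lambda>z. f z + g z) = sh u v f + sh u v g"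
proof (induction u v f arbitrary: g rule: sh.induct)
  case (3 a u b v f)
  show ?case
    using 3(1)[of "\<lambda>z. g (a # z)"] 3(2)[of "\<lambda>z. g (b # z)"]
    by (simp add: distrib_left)
qed auto

lemma sh_scale: "sh u v (\<lambda>z. c * f z) = c * sh u v f"
  by (induction u v f rule: sh.induct) (auto simp: algebra_simps)

text \<open>Super cocommutativity of the coproduct: the Koszul sign for moving one word past the
  other.\<close>

lemma sh_commute: "sh u v g = ksign (opar u) (opar v) * sh v u g"
proof (induction u v g rule: sh.induct)
  case (3 a u b v g)
  have "sh (a # u) (b # v) g = ksign (opar u) (opar (b # v)) * sh (b # v) u (\<lambda>z. g (a # z))
     + ksign (fst b) (opar (a # u)) * (ksign (opar (a # u)) (opar v) * sh v (a # u) (\<lambda>z. g (b # z)))"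
    using 3 by simp
  also have "\<dots> = ksign (opar (a # u)) (opar (b # v)) * sh (b # v) (a # u) g"
    by (auto simp: ksign_def)
  finally show ?case .
qed auto

text \<open>All shuffles are at most \<open>u @ wpow v (i + j)\<close> and \<open>g\<close> vanishes
  below this word, so by strictness only shuffles that read all of \<open>u\<close> first survive.
  Letters of the first word pass nothing and bring no sign.\<close>

lemma sh_above_wpows:
  assumes "lyndon v" "above_wpows v u"
    and "\<And>z. z < u @ wpow v (i + j) \<Longrightarrow> g z = 0"
  shows "sh (u @ wpow v i) (wpow v j) g = sh (wpow v i) (wpow v j) (\<lambda>z. g (u @ z))"
  using assms(2,3)
proof (induction u arbitrary: g)
  case Nil
  then show ?case by simp
next
  case (Cons a u)
  have tail: "sh (u @ wpow v i) (wpow v j) (\<lambda>z. g (a # z))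
      = sh (wpow v i) (wpow v j) (\<lambda>z. g (a # u @ z))"
    using Cons.IH[of "\<lambda>z. g (a # z)", OF above_wpows_Cons[OF Cons.prems(1)]] Cons.prems(2) by simp
  show ?case
  proof (cases "wpow v j")
    case Nil
    then show ?thesis by (simp del: concat_eq_Nil_conv)
  next
    case wj: (Cons c y)
    have "sh (a # u @ wpow v i) y (\<lambda>z. g (c # z)) = 0"
      using shuffle_less[OF assms(1) Cons.prems(1) _ wj, of _ i] Cons.prems(2)
      by (intro sh_eq_0) simp
    then show ?thesis using tail wj by simp
  qed
qed

text \<open>The Gaussian binomial coefficient (i+j choose i) at q = -1 if p holds, and at q = 1 otherwise.\<close>

fun sbinom :: "bool \<Rightarrow> nat \<Rightarrow> nat \<Rightarrow> complex" where
  "sbinom p 0 j = 1"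
| "sbinom p (Suc i) 0 = 1"
| "sbinom p (Suc i) (Suc j) = sbinom p i (Suc j) + (if p \<and> even i then -1 else 1) * sbinom p (Suc i) j"

lemma sbinom_Nil_right [simp]: "sbinom p i 0 = 1"
  by (cases i) auto

lemma opar_wpow: "opar (wpow v n) \<longleftrightarrow> opar v \<and> odd n"
  by (induction n) auto

text \<open>By \<open>sh_above_wpows\<close> a copy of \<open>v\<close>, once begun, is read to its
  end. The copies therefore shuffle like single letters of the parity of \<open>v\<close>, which is
  the recursion of \<open>sbinom\<close>.\<close>

lemma sh_wpow_wpow:
  assumes "lyndon v"
    and "\<And>z. z < wpow v (i + j) \<Longrightarrow> g z = 0"
  shows "sh (wpow v i) (wpow v j) g = sbinom (opar v) i j * g (wpow v (i + j))"
  using assms(2)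
proof (induction "opar v" i j arbitrary: g rule: sbinom.induct)
  case (3 i j)
  obtain a v' where v: "v = a # v'" using assms(1) by (cases v) (auto simp: lyndon_def)
  have above: "above_wpows v v'" using lyndon_above_wpows assms(1) v by blast
  have 1: "sh (v' @ wpow v i) (wpow v (Suc j)) (\<lambda>z. g (a # z))
      = sh (wpow v i) (wpow v (Suc j)) (\<lambda>z. g (v @ z))"
    using sh_above_wpows[OF assms(1) above, of i "Suc j" "\<lambda>z. g (a # z)"] 3(3) v by simp
  have 2: "sh (v' @ wpow v j) (wpow v (Suc i)) (\<lambda>z. g (a # z))
      = sh (wpow v j) (wpow v (Suc i)) (\<lambda>z. g (v @ z))"
    using sh_above_wpows[OF assms(1) above, of j "Suc i" "\<lambda>z. g (a # z)"] 3(3) v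
    by (simp add: add.commute)
  have "sh (wpow v (Suc i)) (wpow v (Suc j)) g
      = sh (v' @ wpow v i) (wpow v (Suc j)) (\<lambda>z. g (a # z))
       + ksign (fst a) (opar (wpow v (Suc i))) * sh (wpow v (Suc i)) (v' @ wpow v j) (\<lambda>z. g (a # z))"
    using v by simp
  also have "sh (wpow v (Suc i)) (v' @ wpow v j) (\<lambda>z. g (a # z))
      = ksign (opar (wpow v (Suc i))) (opar (v' @ wpow v j)) * sh (wpow v j) (wpow v (Suc i)) (\<lambda>z. g (v @ z))"
    using sh_commute 2 by metis
  also have "sh (wpow v j) (wpow v (Suc i)) (\<lambda>z. g (v @ z))
      = ksign (opar (wpow v j)) (opar (wpow v (Suc i))) * sh (wpow v (Suc i)) (wpow v j) (\<lambda>z. g (v @ z))"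
    by (rule sh_commute)
  also note 1
  also have "sh (wpow v i) (wpow v (Suc j)) (\<lambda>z. g (v @ z)) = sbinom (opar v) i (Suc j) * g (wpow v (Suc i + Suc j))"
    using 3(1)[of "\<lambda>z. g (v @ z)"] 3(3) by simp
  also have "sh (wpow v (Suc i)) (wpow v j) (\<lambda>z. g (v @ z)) = sbinom (opar v) (Suc i) j * g (wpow v (Suc i + Suc j))"
    using 3(2)[of "\<lambda>z. g (v @ z)"] 3(3) by simp
  \<comment> \<open>The three signs combine to that of moving one copy of \<open>v\<close> past
    \<open>wpow v (Suc i)\<close>: it is -1 exactly if \<open>v\<close> is odd and
    \<open>Suc i\<close> is odd.\<close>
  also have "ksign (fst a) (opar (wpow v (Suc i))) * (ksign (opar (wpow v (Suc i))) (opar (v' @ wpow v j)) *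
     (ksign (opar (wpow v j)) (opar (wpow v (Suc i))) * (sbinom (opar v) (Suc i) j * g (wpow v (Suc i + Suc j)))))
     = (if opar v \<and> even i then -1 else 1) * sbinom (opar v) (Suc i) j * g (wpow v (Suc i + Suc j))"
    using v by (auto simp: ksign_def opar_wpow)
  finally show ?case by (simp add: algebra_simps)
qed auto

lemma sbinom_even: "sbinom False 1 j = of_nat (Suc j)"
  by (induction j) auto

lemma sbinom_odd: "sbinom True 2 j = of_nat (Suc (j div 2))"
proof (induction j)
  case (Suc j)
  have 1: "sbinom True (Suc 0) j = (if even j then 1 else 0)" for j
    by (induction j) auto
  have "sbinom True 2 (Suc j) = sbinom True (Suc 0) (Suc j) + sbinom True 2 j"
    by (simp add: numeral_2_eq_2)
  also have "\<dots> = of_nat (Suc (Suc j div 2))"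
    unfolding 1 Suc by (cases "even j") (auto elim!: oddE evenE)
  finally show ?case .
qed auto

definition super_lyndon :: "letter list \<Rightarrow> bool" where
  "super_lyndon w \<longleftrightarrow> lyndon w \<or> (\<exists>l. lyndon l \<and> opar l \<and> w = l @ l)"

lemma shuffle_reduction:
  assumes "w \<noteq> []" "\<not> super_lyndon w"
  obtains u v c where "u \<noteq> []" "v \<noteq> []" "length u + length v = length w" "c \<noteq> 0"
    "\<And>g. (\<And>z. z < w \<Longrightarrow> g z = 0) \<Longrightarrow> sh u v g = c * g w"
proof -
  obtain u v j where w: "w = u @ wpow v j" "j > 0" "lyndon v" "above_wpows v u"
    using lyndon_decomposition[OF assms(1)] by blast
  have "v \<noteq> []" using w(3) by (auto simp: lyndon_def)
  show ?thesis
  proof (cases "u = []")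
    case False
    \<comment> \<open>The cut before the whole power: \<open>w\<close> is the largest shuffle and
      arises once, hence the coefficient 1.\<close>
    show ?thesis
    proof (rule that[of u "wpow v j" 1])
      fix g :: tensor assume "\<And>z. z < w \<Longrightarrow> g z = 0"
      then show "sh u (wpow v j) g = 1 * g w"
        using sh_above_wpows[OF w(3,4), of 0 j g] w(1) by simp
    qed (use False w \<open>v \<noteq> []\<close> in auto)
  next
    case True
    \<comment> \<open>One copy is split off if \<open>v\<close> is even and two if it is odd, since
      \<open>sbinom True 1\<close> vanishes at odd arguments. Not being super-Lyndon says exactly
      that copies remain on the other side.\<close>
    define i :: nat where "i = (if opar v then 2 else 1)"
    have "i < j"
    proof (rule ccontr)
      assume "\<not> i < j"
      then consider "j = 1" | "j = 2" "opar v" using w(2) unfolding i_def by (force split: if_splits)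
      then show False using assms(2) w(1,3) True unfolding super_lyndon_def
        by cases (auto simp: numeral_2_eq_2)
    qed
    show ?thesis
    proof (rule that[of "wpow v i" "wpow v (j - i)" "sbinom (opar v) i (j - i)"])
      show "wpow v i \<noteq> []" "wpow v (j - i) \<noteq> []"
        using \<open>v \<noteq> []\<close> \<open>i < j\<close> by (auto simp: i_def)
      show "length (wpow v i) + length (wpow v (j - i)) = length w"
        using True w(1) \<open>i < j\<close> by (metis append_Nil le_add_diff_inverse length_append less_imp_le wpow_add)
      show "sbinom (opar v) i (j - i) \<noteq> 0"
        using sbinom_even[of "j - i"] sbinom_odd[of "j - i"] unfolding i_def
        by (auto simp del: of_nat_Suc)
      fix g :: tensor assume "\<And>z. z < w \<Longrightarrow> g z = 0"
      then show "sh (wpow v i) (wpow v (j - i)) g = sbinom (opar v) i (j - i) * g w"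
        using sh_wpow_wpow[OF w(3), of i "j - i" g] w(1) True \<open>i < j\<close> by simp
    qed
  qed
qed

definition shuffle_orthogonal :: "tensor set" where
  "shuffle_orthogonal = {f. \<forall>u v. u \<noteq> [] \<longrightarrow> v \<noteq> [] \<longrightarrow> sh u v f = 0}"

lemma shuffle_orthogonal_eq_0:
  assumes "f \<in> shuffle_orthogonal" "finite {w. f w \<noteq> 0}" "f [] = 0"
    and "\<And>w. super_lyndon w \<Longrightarrow> f w = 0"
  shows "f = (\<lambda>w. 0)"
proof (rule ccontr)
  assume "f \<noteq> (\<lambda>w. 0)"
  then have "{w. f w \<noteq> 0} \<noteq> {}" by auto
  \<comment> \<open>The least word of the support: \<open>f\<close> vanishes below it, so the
    shuffle with largest term \<open>w\<close> sees only \<open>f w\<close>.\<close>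
  define w where "w = Min {w. f w \<noteq> 0}"
  have "f w \<noteq> 0" using Min_in[OF assms(2)] \<open>_ \<noteq> {}\<close> unfolding w_def by blast
  have below: "f z = 0" if "z < w" for z
    using that Min_le[OF assms(2), of z] unfolding w_def by force
  have "w \<noteq> []" "\<not> super_lyndon w" using \<open>f w \<noteq> 0\<close> assms(3,4) by auto
  then obtain u v c where uv: "u \<noteq> []" "v \<noteq> []" "c \<noteq> 0"
    "\<And>g. (\<And>z. z < w \<Longrightarrow> g z = 0) \<Longrightarrow> sh u v g = c * g w"
    by (rule shuffle_reduction) blast
  have "c * f w = sh u v f" using uv(4)[OF below] by simp
  also have "\<dots> = 0" using assms(1) uv(1,2) unfolding shuffle_orthogonal_def by simp
  finally have "c * f w = 0" .
  with \<open>f w \<noteq> 0\<close> uv(3) show False by simp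
qed

section \<open>Lie elements\<close>

lemma tmult_Cons: "tmult f g (a # z) = f [] * g (a # z) + tmult (\<lambda>z. f (a # z)) g z"
  by (simp add: tmult_def atLeast0AtMost sum.atMost_Suc_shift del: sum.atMost_Suc)

text \<open>The coproduct is multiplicative for concatenation. The sign comes from moving the part
  of \<open>u\<close> that goes to \<open>g\<close> past the part of \<open>v\<close> that goes to
  \<open>f\<close>.\<close>

lemma sh_tmult:
  "sh u v (tmult f g) = (\<Sum>i\<le>length u. \<Sum>j\<le>length v.
     ksign (opar (drop i u)) (opar (take j v)) * sh (take i u) (take j v) f * sh (drop i u) (drop j v) g)"
proof (induction u v f rule: sh.induct)
  case (1 v f)
  then show ?case by (simp add: tmult_def atLeast0AtMost)
next
  case (2 a u f)
  then show ?case by (simp add: tmult_def atLeast0AtMost del: sum.atMost_Suc)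
next
  case (3 a u b v f)
  define fa where "fa = (\<lambda>z. f (a # z))"
  define fb where "fb = (\<lambda>z. f (b # z))"
  define e where "e = ksign (fst b) (opar (a # u))"
  \<comment> \<open>\<open>T\<close> is the claimed summand; \<open>A\<close> and \<open>B\<close>
    are the summands supplied by the induction once a first letter of the left factor comes from
    \<open>u\<close> or from \<open>v\<close>. The recursion of \<open>sh\<close> expresses every
    \<open>T\<close> except \<open>T 0 0\<close> through them.\<close>
  define T where "T = (\<lambda>i j. ksign (opar (drop i (a # u))) (opar (take j (b # v))) *
    sh (take i (a # u)) (take j (b # v)) f * sh (drop i (a # u)) (drop j (b # v)) g)"
  define A where "A = (\<lambda>i j. ksign (opar (drop i u)) (opar (take j (b # v))) *
    sh (take i u) (take j (b # v)) fa * sh (drop i u) (drop j (b # v)) g)"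
  define B where "B = (\<lambda>i j. ksign (opar (drop i (a # u))) (opar (take j v)) *
    sh (take i (a # u)) (take j v) fb * sh (drop i (a # u)) (drop j v) g)"
  have opar_split: "opar u \<longleftrightarrow> (opar (take i u) \<noteq> opar (drop i u))" for i
    using opar_simps(3)[of "take i u" "drop i u"] by simp
  have T0: "T 0 0 = f [] * sh (a # u) (b # v) g" by (simp add: T_def)
  have T1: "T (Suc i) 0 = A i 0" for i by (simp add: T_def A_def fa_def)
  have T2: "T 0 (Suc j) = e * B 0 j" for j
    by (auto simp: T_def B_def fb_def e_def ksign_def)
  have T3: "T (Suc i) (Suc j) = A i (Suc j) + e * B (Suc i) j" for i j
    using opar_split[of i]
    by (cases "opar (take i u)"; cases "opar (drop i u)"; cases "fst a"; cases "opar (take j v)"; cases "fst b")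
       (simp_all add: T_def A_def B_def e_def fa_def fb_def algebra_simps)
  have "sh (a # u) (b # v) (tmult f g) = f [] * sh (a # u) (b # v) g
      + sh u (b # v) (tmult fa g) + e * sh (a # u) v (tmult fb g)"
    by (simp add: tmult_Cons sh_add sh_scale fa_def fb_def e_def algebra_simps)
  also have "sh u (b # v) (tmult fa g) = (\<Sum>i\<le>length u. \<Sum>j\<le>Suc (length v). A i j)"
    unfolding A_def fa_def 3 by simp
  also have "sh (a # u) v (tmult fb g) = (\<Sum>i\<le>Suc (length u). \<Sum>j\<le>length v. B i j)"
    unfolding B_def fb_def 3 by simp
  also have "f [] * sh (a # u) (b # v) g + (\<Sum>i\<le>length u. \<Sum>j\<le>Suc (length v). A i j)
      + e * (\<Sum>i\<le>Suc (length u). \<Sum>j\<le>length v. B i j) = (\<Sum>i\<le>Suc (length u). \<Sum>j\<le>Suc (length v). T i j)"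
    by (simp add: sum.atMost_Suc_shift T0 T1 T2 T3 sum.distrib sum_distrib_left algebra_simps
        del: sum.atMost_Suc)
  finally show ?case by (simp add: T_def)
qed

definition homogeneous :: "bool \<Rightarrow> tensor \<Rightarrow> bool" where
  "homogeneous p f \<longleftrightarrow> (\<forall>w. f w \<noteq> 0 \<longrightarrow> opar w = p)"

lemma shuffle_orthogonalD: "f \<in> shuffle_orthogonal \<Longrightarrow> u \<noteq> [] \<Longrightarrow> v \<noteq> [] \<Longrightarrow> sh u v f = 0"
  by (simp add: shuffle_orthogonal_def)

text \<open>A summand dies if both prefixes or both remainders are nonempty, by orthogonality of
  \<open>f\<close> or of \<open>g\<close>. This leaves the four corners of the double sum; two of
  them contain the vanishing constant terms.\<close>

lemma sh_tmult_primitive: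
  assumes "f \<in> shuffle_orthogonal" "g \<in> shuffle_orthogonal" "f [] = 0" "g [] = 0"
    and "u \<noteq> []" "v \<noteq> []"
  shows "sh u v (tmult f g) = f u * g v + ksign (opar u) (opar v) * (f v * g u)"
proof -
  define X where "X = ksign (opar u) (opar v) * (f v * g u)"
  define Y where "Y = f u * g v"
  have "sh u v (tmult f g) = (\<Sum>i\<le>length u. \<Sum>j\<le>length v.
      (if i = 0 then if j = length v then X else 0 else 0)
      + (if i = length u then if j = 0 then Y else 0 else 0))"
    unfolding sh_tmult
  proof (intro sum.cong refl, goal_cases)
    case (1 i j)
    consider "i = 0" "j = 0" | "i = length u" "j = length v" | "i = 0" "j = length v"
      | "i = length u" "j = 0" | "i \<noteq> 0" "j \<noteq> 0" "i < length u \<or> j < length v"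
      | "i < length u" "j < length v"
      using 1 assms(5,6)
      by (cases "i = 0"; cases "j = 0"; cases "i = length u"; cases "j = length v") auto
    then show ?case
    proof cases
      case 5
      then show ?thesis using assms shuffle_orthogonalD[OF assms(1), of "take i u" "take j v"] by simp
    next
      case 6
      then show ?thesis using assms shuffle_orthogonalD[OF assms(2), of "drop i u" "drop j v"] by simp
    qed (use assms in \<open>auto simp: X_def Y_def\<close>)
  qed
  also have "\<dots> = (\<Sum>i\<le>length u. (if i = 0 then X else 0) + (if i = length u then Y else 0))"
    by (intro sum.cong refl) (auto simp: sum.distrib)
  also have "\<dots> = X + Y" by (simp add: sum.distrib)
  finally show ?thesis by (simp add: X_def Y_def)
qed

lemma sbracket_eq: "sbracket p f q g = (\<lambda>w. tmult f g w + (- ksign p q) * tmult g f w)"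
  by (simp add: sbracket_def cscale_def ksign_def fun_eq_iff)

text \<open>Products of primitive elements have mixed terms in their coproduct; the sign in the
  super bracket is the one that cancels them.\<close>

lemma sbracket_shuffle_orthogonal:
  assumes "f \<in> shuffle_orthogonal" "g \<in> shuffle_orthogonal" "f [] = 0" "g [] = 0"
    and "homogeneous p f" "homogeneous q g"
  shows "sbracket p f q g \<in> shuffle_orthogonal"
  unfolding shuffle_orthogonal_def
proof (safe, goal_cases)
  case (1 u v)
  \<comment> \<open>\<open>A\<close> and \<open>B\<close> stand for the two mixed terms,
    \<open>e\<close> for the Koszul sign of the words and \<open>s\<close> for that of the factors.
    Homogeneity gives \<open>e = s\<close> wherever a mixed term is nonzero.\<close>
  have key: "A + e * B + - s * (B + e * A) = 0" if "A = s * (e * A)" "e * B = s * B" for A B e s :: complex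
  proof -
    have "A + e * B + - s * (B + e * A) = (A - s * (e * A)) + (e * B - s * B)"
      by (simp add: algebra_simps)
    also have "\<dots> = 0" using that by (metis add.right_neutral diff_self)
    finally show ?thesis .
  qed
  have "f u * g v = ksign p q * (ksign (opar u) (opar v) * (f u * g v))"
    using assms(5,6) by (cases "f u * g v = 0") (auto simp: homogeneous_def)
  moreover have "ksign (opar u) (opar v) * (f v * g u) = ksign p q * (f v * g u)"
    using assms(5,6) by (cases "f v * g u = 0") (auto simp: homogeneous_def ksign_commute[of q p])
  ultimately show ?case
    unfolding sbracket_eq sh_add sh_scale
      sh_tmult_primitive[OF assms(1-4) 1] sh_tmult_primitive[OF assms(2,1,4,3) 1]
    using key[of "f u * g v" "ksign p q" "ksign (opar u) (opar v)" "f v * g u"]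
    by (simp add: mult.commute)
qed

section \<open>Supports of Lie elements\<close>

definition words :: "nat \<Rightarrow> nat \<Rightarrow> nat \<Rightarrow> letter list set" where
  "words N n m = {w. (\<forall>a\<in>set w. snd a \<in> {1..N})
     \<and> length (filter (\<lambda>a. \<not> fst a) w) = n \<and> length (filter fst w) = m}"

lemma length_words: "w \<in> words N n m \<Longrightarrow> length w = n + m"
  unfolding words_def using sum_length_filter_compl[of fst w] by auto

lemma finite_words [simp]: "finite (words N n m)"
proof (rule finite_subset)
  show "words N n m \<subseteq> {w. set w \<subseteq> UNIV \<times> {1..N} \<and> length w = n + m}"
    using length_words by (auto simp: words_def)
qed (simp add: finite_lists_length_eq)

lemma opar_words: "w \<in> words N n m \<Longrightarrow> opar w = odd m"
  by (auto simp: words_def opar_def)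

lemma append_words: "u \<in> words N n m \<Longrightarrow> v \<in> words N n' m' \<Longrightarrow> u @ v \<in> words N (n + n') (m + m')"
  by (auto simp: words_def)

lemma mset_words: "mset u = mset v \<Longrightarrow> u \<in> words N n m \<longleftrightarrow> v \<in> words N n m"
proof -
  assume eq: "mset u = mset v"
  have "length (filter P u) = length (filter P v)" for P
    using eq by (metis mset_filter size_mset)
  then show ?thesis using mset_eq_setD[OF eq] by (auto simp: words_def)
qed

lemma tmult_neq_0:
  assumes "tmult f g w \<noteq> 0"
  obtains u v where "w = u @ v" "f u \<noteq> 0" "g v \<noteq> 0"
proof -
  from assms obtain k where "f (take k w) * g (drop k w) \<noteq> 0"
    unfolding tmult_def by (meson sum.neutral)
  then show ?thesis using that[of "take k w" "drop k w"] by simp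
qed

lemma sbracket_neq_0:
  assumes "sbracket p f q g w \<noteq> 0"
  obtains u v where "w = u @ v" "f u \<noteq> 0" "g v \<noteq> 0" | u v where "w = v @ u" "f u \<noteq> 0" "g v \<noteq> 0"
proof -
  from assms have "tmult f g w \<noteq> 0 \<or> tmult g f w \<noteq> 0" by (auto simp: sbracket_eq)
  then show ?thesis
    by (elim disjE tmult_neq_0) (use that in blast)+
qed

lemma leaves_neq_Nil [simp]: "leaves t \<noteq> []"
  by (induction t) auto

lemma beval_words:
  assumes "\<forall>(p, v)\<in>set (leaves t). v \<in> Vpart N p" "beval t w \<noteq> 0"
  shows "w \<in> words N (length (filter (\<lambda>a. \<not> fst a) (leaves t))) (length (filter fst (leaves t)))"
  using assms
proof (induction t arbitrary: w)
  case (Leaf a)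
  then show ?case by (cases a) (auto simp: Vpart_def words_def)
next
  case (Node s t)
  from Node.prems(2) have "sbracket (tpar s) (beval s) (tpar t) (beval t) w \<noteq> 0" by simp
  then show ?case
  proof (cases rule: sbracket_neq_0)
    case (1 u v)
    then show ?thesis
      using append_words[OF Node.IH(1)[of u] Node.IH(2)[of v]] Node.prems(1) by simp
  next
    case (2 u v)
    then show ?thesis
      using append_words[OF Node.IH(2)[of v] Node.IH(1)[of u]] Node.prems(1)
      by (simp add: add.commute)
  qed
qed

lemma beval_Nil:
  assumes "\<forall>(p, v)\<in>set (leaves t). v \<in> Vpart N p"
  shows "beval t [] = 0"
proof (rule ccontr)
  assume "beval t [] \<noteq> 0"
  from length_words[OF beval_words[OF assms this]] show False
    using sum_length_filter_compl[of fst "leaves t"] by simp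
qed

lemma beval_homogeneous:
  assumes "\<forall>(p, v)\<in>set (leaves t). v \<in> Vpart N p"
  shows "homogeneous (tpar t) (beval t)"
  unfolding homogeneous_def using opar_words[OF beval_words[OF assms]] by (simp add: tpar_def)

lemma beval_shuffle_orthogonal:
  assumes "\<forall>(p, v)\<in>set (leaves t). v \<in> Vpart N p"
  shows "beval t \<in> shuffle_orthogonal"
  using assms
proof (induction t)
  case (Leaf a)
  have "f z = 0" if "z \<in> shuffles u v" "u \<noteq> []" "v \<noteq> []" "f \<in> Vpart N p" for f p z u v
  proof (rule ccontr)
    assume "f z \<noteq> 0"
    with that(4) have "length z = 1" by (auto simp: Vpart_def)
    with length_shuffles[OF that(1)] that(2,3) show False by (cases u; cases v) auto
  qed
  with Leaf show ?case
    unfolding shuffle_orthogonal_def by (cases a) (auto intro!: sh_eq_0)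
next
  case (Node s t)
  then have "\<forall>(p, v)\<in>set (leaves s). v \<in> Vpart N p" "\<forall>(p, v)\<in>set (leaves t). v \<in> Vpart N p" by auto
  with Node.IH show ?case
    by (simp add: sbracket_shuffle_orthogonal beval_Nil beval_homogeneous)
qed

lemma freeLie_subset:
  "freeLie N n m \<subseteq> {f \<in> shuffle_orthogonal. \<forall>w. f w \<noteq> 0 \<longrightarrow> w \<in> words N n m}"
  unfolding freeLie_def
proof (rule tvs.span_minimal)
  show "tvs.subspace {f \<in> shuffle_orthogonal. \<forall>w. f w \<noteq> 0 \<longrightarrow> w \<in> words N n m}"
    unfolding tvs.subspace_def
  proof (safe, goal_cases)
    case 1
    show ?case by (auto simp: shuffle_orthogonal_def intro: sh_eq_0)
  next
    case (3 f g)
    then show ?case by (auto simp: shuffle_orthogonal_def plus_fun_def sh_add)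
  next
    case (4 f g w)
    then show ?case by (metis add.right_neutral plus_fun_def)
  next
    case (5 c f)
    then show ?case by (auto simp: shuffle_orthogonal_def cscale_def sh_scale)
  qed (auto simp: cscale_def)
qed (use beval_words beval_shuffle_orthogonal in fastforce)

section \<open>Brackets with a prescribed leading word\<close>

lemma lyndon_factorization:
  fixes l :: "'a::linorder list"
  assumes "lyndon l" "length l \<ge> 2"
  obtains u v where "l = u @ v" "lyndon u" "lyndon v"
proof -
  have tl: "tl l \<noteq> []" using assms(2) by (cases l) auto
  then have l: "l = [hd l] @ tl l" by (cases l) auto
  \<comment> \<open>The standard factorization: \<open>v\<close> is the smallest proper suffix of
    \<open>l\<close>.\<close>
  obtain v where v: "suffix v (tl l)" "v \<noteq> []" "\<And>s. suffix s (tl l) \<Longrightarrow> s \<noteq> [] \<Longrightarrow> v \<le> s"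
    using smallest_suffix[OF tl] by blast
  obtain u' where u': "tl l = u' @ v" using v(1) by (auto simp: suffix_def)
  define u where "u = hd l # u'"
  have luv: "l = u @ v" using l u' by (simp add: u_def)
  have "lyndon u"
    unfolding lyndon_def
  proof (intro conjI allI impI)
    show "u \<noteq> []" by (simp add: u_def)
    fix a b assume ab: "u = a @ b" "a \<noteq> []" "b \<noteq> []"
    have "u @ v < b @ v" using lyndonD[of a "b @ v"] assms(1) luv ab by simp
    show "u < b"
    proof (rule ccontr)
      assume "\<not> u < b"
      moreover have "u \<noteq> b" using ab by auto
      ultimately have "b < u" by simp
      \<comment> \<open>Otherwise \<open>b < u\<close> would persist after appending
        \<open>v\<close>. With \<open>u = b @ t\<close>, the proper suffix \<open>t @ v\<close> of
        \<open>l\<close> then lies below \<open>v\<close>, against the choice of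
        \<open>v\<close>.\<close>
      have "prefix b u"
        using append_less_append[OF \<open>b < u\<close>, of v v] \<open>u @ v < b @ v\<close> by force
      then obtain t where t: "u = b @ t" by (auto simp: prefix_def)
      have "t \<noteq> []" using t \<open>u \<noteq> b\<close> by auto
      have "t @ v < v" using \<open>u @ v < b @ v\<close> t by simp
      moreover have "suffix (t @ v) (tl l)"
      proof -
        obtain b0 b' where "b = b0 # b'" using ab(3) by (cases b) auto
        then have "tl l = b' @ t @ v" using luv t by simp
        then show ?thesis by (auto simp: suffix_def)
      qed
      ultimately show False using v(3)[of "t @ v"] v(2) by simp
    qed
  qed
  then show ?thesis using that luv smallest_suffix_lyndon[OF v] by blast
qed

definition unit_tensor :: "letter \<Rightarrow> tensor" where
  "unit_tensor a = (\<lambda>w. if w = [a] then 1 else 0)"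

text \<open>The multiset condition does double duty: it fixes the length of the words, so that
  leading words multiply, and it makes the value an eigenvector of the torus. The leaves place the
  bracket in the right \<open>freeLie\<close> component.\<close>

definition leading_tree :: "(bool \<times> tensor) btree \<Rightarrow> letter list \<Rightarrow> bool" where
  "leading_tree t l \<longleftrightarrow> leaves t = map (\<lambda>a. (fst a, unit_tensor a)) l \<and> beval t l \<noteq> 0
     \<and> (\<forall>w. beval t w \<noteq> 0 \<longrightarrow> l \<le> w \<and> mset w = mset l)"

lemma leading_treeD:
  assumes "leading_tree t l"
  shows "leaves t = map (\<lambda>a. (fst a, unit_tensor a)) l" "beval t l \<noteq> 0"
    "beval t w \<noteq> 0 \<Longrightarrow> l \<le> w \<and> mset w = mset l"
  using assms unfolding leading_tree_def by blast+

text \<open>Lexicographic order respects appending on the right for words of equal length, which the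
  multiset condition provides; equal lengths also leave a single contributing cut.\<close>

lemma tmult_leading:
  assumes "\<And>w. f w \<noteq> 0 \<Longrightarrow> u \<le> w \<and> mset w = mset u" "\<And>w. g w \<noteq> 0 \<Longrightarrow> v \<le> w \<and> mset w = mset v"
  shows "tmult f g w \<noteq> 0 \<Longrightarrow> u @ v \<le> w \<and> mset w = mset (u @ v)"
    and "tmult f g (u @ v) = f u * g v"
proof -
  assume "tmult f g w \<noteq> 0"
  then obtain x y where xy: "w = x @ y" "f x \<noteq> 0" "g y \<noteq> 0" by (rule tmult_neq_0)
  with assms have le: "u \<le> x" "v \<le> y" and m: "mset x = mset u" "mset y = mset v" by blast+
  have "u @ v \<le> x @ y"
  proof (cases "u = x")
    case False
    with le(1) have "u < x" by simp
    from append_less_append_same_length[OF this mset_eq_length[OF m(1)[symmetric]]] show ?thesis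
      by (simp add: less_imp_le)
  qed (use le in simp)
  with xy m show "u @ v \<le> w \<and> mset w = mset (u @ v)" by simp
next
  have "f (take k (u @ v)) * g (drop k (u @ v)) = (if k = length u then f u * g v else 0)"
    if "k \<le> length (u @ v)" for k
  proof (cases "k = length u")
    case False
    have "f (take k (u @ v)) = 0"
    proof (rule ccontr)
      assume "f (take k (u @ v)) \<noteq> 0"
      with assms(1) have "mset (take k (u @ v)) = mset u" by blast
      from mset_eq_length[OF this] that False show False by simp
    qed
    with False show ?thesis by simp
  qed simp
  then show "tmult f g (u @ v) = f u * g v"
    unfolding tmult_def by (subst sum.cong[OF refl]) auto
qed

text \<open>The two products in the bracket have leading words \<open>u @ v\<close> and
  \<open>v @ u\<close>. The second is strictly larger because \<open>u @ v\<close> is Lyndon, so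
  nothing cancels at \<open>l\<close>.\<close>

lemma lyndon_leading_tree:
  assumes "lyndon l"
  shows "\<exists>t. leading_tree t l"
  using assms
proof (induction l rule: measure_induct_rule[of length])
  case (less l)
  show ?case
  proof (cases "length l \<ge> 2")
    case False
    then obtain a where "l = [a]"
      using less.prems unfolding lyndon_def by (cases l; cases "tl l") auto
    then have "leading_tree (Leaf (fst a, unit_tensor a)) l"
      by (auto simp: leading_tree_def unit_tensor_def)
    then show ?thesis by blast
  next
    case True
    then obtain u v where uv: "l = u @ v" "lyndon u" "lyndon v"
      using lyndon_factorization less.prems by blast
    then have ne: "u \<noteq> []" "v \<noteq> []" by (auto simp: lyndon_def)
    then have "length u < length l" "length v < length l" using uv(1) by auto
    then obtain s t where st: "leading_tree s u" "leading_tree t v"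
      using less.IH uv(2,3) by blast
    have lt: "l < v @ u" using lyndon_append_less[of u v "[]" u] less.prems uv(1) ne by simp
    have supp: "\<And>w. beval s w \<noteq> 0 \<Longrightarrow> u \<le> w \<and> mset w = mset u"
      "\<And>w. beval t w \<noteq> 0 \<Longrightarrow> v \<le> w \<and> mset w = mset v"
      using st by (blast dest: leading_treeD(3))+
    note su = tmult_leading[OF supp, simplified] and tu = tmult_leading[OF supp(2,1), simplified]
    have "leading_tree (Node s t) l"
      unfolding leading_tree_def
    proof (intro conjI allI impI)
      show "leaves (Node s t) = map (\<lambda>a. (fst a, unit_tensor a)) l"
        using st[THEN leading_treeD(1)] uv(1) by simp
      have "tmult (beval t) (beval s) l = 0"
        using tu(1)[where w = l] lt by force
      moreover have "tmult (beval s) (beval t) l = beval s u * beval t v"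
        using su(2) uv(1) by simp
      ultimately show "beval (Node s t) l \<noteq> 0"
        using st[THEN leading_treeD(2)] by (simp add: sbracket_eq)
      fix w assume "beval (Node s t) w \<noteq> 0"
      then have "tmult (beval s) (beval t) w \<noteq> 0 \<or> tmult (beval t) (beval s) w \<noteq> 0"
        by (auto simp: sbracket_eq)
      then have "l \<le> w \<and> mset w = mset l \<or> v @ u \<le> w \<and> mset w = mset l"
        using su(1)[where w = w] tu(1)[where w = w] uv(1) by (simp add: add.commute) blast
      then show "l \<le> w" "mset w = mset l" using lt by auto
    qed
    then show ?thesis by blast
  qed
qed

lemma super_lyndon_leading_tree:
  assumes "super_lyndon w"
  shows "\<exists>t. leading_tree t w"
proof -
  consider "lyndon w" | l where "lyndon l" "opar l" "w = l @ l"
    using assms unfolding super_lyndon_def by blast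
  then show ?thesis
  proof cases
    case 1
    then show ?thesis by (rule lyndon_leading_tree)
  next
    case 2
    obtain t where t: "leading_tree t l" using lyndon_leading_tree[OF 2(1)] by blast
    have supp: "\<And>w. beval t w \<noteq> 0 \<Longrightarrow> l \<le> w \<and> mset w = mset l"
      using t by (blast dest: leading_treeD(3))
    note tl = tmult_leading[OF supp supp, simplified]
    have "tpar t" using leading_treeD(1)[OF t] 2(2) by (simp add: tpar_def opar_def filter_map comp_def)
    \<comment> \<open>For an odd element the super bracket with itself is twice the square.\<close>
    then have eq: "beval (Node t t) z = 2 * tmult (beval t) (beval t) z" for z
      by (simp add: sbracket_eq)
    have "leading_tree (Node t t) w"
      unfolding leading_tree_def eq
    proof (intro conjI allI impI)
      show "leaves (Node t t) = map (\<lambda>a. (fst a, unit_tensor a)) w"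
        using leading_treeD(1)[OF t] 2(3) by simp
      have "tmult (beval t) (beval t) w = beval t l * beval t l"
        using tl(2) 2(3) by simp
      then show "2 * tmult (beval t) (beval t) w \<noteq> 0" using leading_treeD(2)[OF t] by simp
      fix z assume "2 * tmult (beval t) (beval t) z \<noteq> 0"
      then have "l @ l \<le> z \<and> mset z = mset (l @ l)"
        using tl(1)[where w = z] by simp
      then show "w \<le> z" "mset z = mset w" using 2(3) by auto
    qed
    then show ?thesis by blast
  qed
qed

section \<open>The trace on the free Lie superalgebra\<close>

context vector_space
begin

lemma sum_scale_matrix:
  "(\<Sum>x\<in>X. u x *s (\<Sum>y\<in>Y. M x y *s y)) = (\<Sum>y\<in>Y. (\<Sum>x\<in>X. u x * M x y) *s y)"
  unfolding scale_sum_right scale_sum_left scale_scale by (rule sum.swap)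

lemma independent_coeff_unique:
  assumes "finite B" "independent B" "(\<Sum>c\<in>B. u c *s c) = (\<Sum>c\<in>B. v c *s c)" "c \<in> B"
  shows "u c = v c"
proof -
  have "(\<Sum>c\<in>B. (u c - v c) *s c) = 0"
    using assms(3) by (simp add: scale_left_diff_distrib sum_subtractf)
  then have "u c - v c = 0"
    using independentD[OF assms(2,1) order_refl _ assms(4), of "\<lambda>c. u c - v c"] by simp
  then show ?thesis by simp
qed

lemma expand_in_basis:
  assumes "finite B" "A \<subseteq> span B"
  obtains P where "\<And>b. b \<in> A \<Longrightarrow> b = (\<Sum>c\<in>B. P b c *s c)"
proof -
  have "\<forall>b\<in>A. \<exists>p. b = (\<Sum>c\<in>B. p c *s c)"
    using assms(2) unfolding span_finite[OF assms(1)] by blast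
  then obtain P where "\<forall>b\<in>A. b = (\<Sum>c\<in>B. P b c *s c)"
    using bchoice[of A "\<lambda>b p. b = (\<Sum>c\<in>B. p c *s c)"] by blast
  then show ?thesis using that by blast
qed

text \<open>With base changes \<open>P\<close> and \<open>Q\<close> one has a = P a' Q and Q P = 1,
  so the claim is cyclicity of the trace.\<close>

lemma trace_basis_independent:
  assumes B: "finite B" "independent B" and B': "finite B'" "independent B'"
    and span: "span B = span B'"
    and add: "\<And>v w. f (v + w) = f v + f w" and scale: "\<And>c v. f (c *s v) = c *s f v"
    and a: "\<And>b. b \<in> B \<Longrightarrow> f b = (\<Sum>c\<in>B. a b c *s c)"
    and a': "\<And>b. b \<in> B' \<Longrightarrow> f b = (\<Sum>c\<in>B'. a' b c *s c)"
  shows "(\<Sum>b\<in>B. a b b) = (\<Sum>b\<in>B'. a' b b)"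
proof -
  obtain P where P: "\<And>b. b \<in> B \<Longrightarrow> b = (\<Sum>c\<in>B'. P b c *s c)"
    using expand_in_basis[OF B'(1), of B] span span_superset[of B] by metis
  obtain Q where Q: "\<And>b. b \<in> B' \<Longrightarrow> b = (\<Sum>c\<in>B. Q b c *s c)"
    using expand_in_basis[OF B(1), of B'] span span_superset[of B'] by metis
  have f0: "f 0 = 0" using scale[of 0 0] by simp
  have fsum: "f (\<Sum>c\<in>S. u c *s c) = (\<Sum>c\<in>S. u c *s f c)" for u S
    by (induction S rule: infinite_finite_induct) (auto simp: add scale f0)
  have QP: "(\<Sum>b\<in>B. Q b' b * P b c') = (if b' = c' then 1 else 0)" if "b' \<in> B'" "c' \<in> B'" for b' c'
  proof -
    have "(\<Sum>c'\<in>B'. (\<Sum>b\<in>B. Q b' b * P b c') *s c') = (\<Sum>b\<in>B. Q b' b *s (\<Sum>c'\<in>B'. P b c' *s c'))"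
      by (rule sum_scale_matrix[symmetric])
    also have "\<dots> = (\<Sum>b\<in>B. Q b' b *s b)" using P by simp
    also have "\<dots> = b'" using Q that(1) by simp
    also have "b' = (\<Sum>c'\<in>B'. (if b' = c' then 1 else 0) *s c')"
      using that(1) B'(1) by (simp add: if_distrib[of "\<lambda>c. c *s _"] cong: if_cong)
    finally show ?thesis
      using independent_coeff_unique[OF B' _ that(2), of "\<lambda>c'. \<Sum>b\<in>B. Q b' b * P b c'"
          "\<lambda>c'. if b' = c' then 1 else 0"] by simp
  qed
  have diag: "a b b = (\<Sum>b'\<in>B'. \<Sum>c'\<in>B'. P b b' * a' b' c' * Q c' b)" if "b \<in> B" for b
  proof -
    have "(\<Sum>c\<in>B. a b c *s c) = f (\<Sum>b'\<in>B'. P b b' *s b')" using a P that by metis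
    also have "\<dots> = (\<Sum>b'\<in>B'. P b b' *s (\<Sum>c'\<in>B'. a' b' c' *s c'))" by (simp add: fsum a')
    also have "\<dots> = (\<Sum>c'\<in>B'. (\<Sum>b'\<in>B'. P b b' * a' b' c') *s c')" by (rule sum_scale_matrix)
    also have "\<dots> = (\<Sum>c'\<in>B'. (\<Sum>b'\<in>B'. P b b' * a' b' c') *s (\<Sum>c\<in>B. Q c' c *s c))"
      using Q by simp
    also have "\<dots> = (\<Sum>c\<in>B. (\<Sum>c'\<in>B'. (\<Sum>b'\<in>B'. P b b' * a' b' c') * Q c' c) *s c)"
      by (rule sum_scale_matrix)
    finally have "a b b = (\<Sum>c'\<in>B'. (\<Sum>b'\<in>B'. P b b' * a' b' c') * Q c' b)"
      by (rule independent_coeff_unique[OF B _ that])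
    also have "\<dots> = (\<Sum>b'\<in>B'. \<Sum>c'\<in>B'. P b b' * a' b' c' * Q c' b)"
      unfolding sum_distrib_right by (rule sum.swap)
    finally show ?thesis .
  qed
  have "(\<Sum>b\<in>B. a b b) = (\<Sum>b\<in>B. \<Sum>b'\<in>B'. \<Sum>c'\<in>B'. P b b' * a' b' c' * Q c' b)"
    using diag by simp
  also have "\<dots> = (\<Sum>b'\<in>B'. \<Sum>b\<in>B. \<Sum>c'\<in>B'. P b b' * a' b' c' * Q c' b)"
    by (rule sum.swap)
  also have "\<dots> = (\<Sum>b'\<in>B'. \<Sum>c'\<in>B'. \<Sum>b\<in>B. P b b' * a' b' c' * Q c' b)"
    by (rule sum.cong[OF refl], rule sum.swap)
  also have "\<dots> = (\<Sum>b'\<in>B'. \<Sum>c'\<in>B'. \<Sum>b\<in>B. a' b' c' * (Q c' b * P b b'))"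
    by (simp add: mult_ac)
  also have "\<dots> = (\<Sum>b'\<in>B'. \<Sum>c'\<in>B'. a' b' c' * (if c' = b' then 1 else 0))"
    unfolding sum_distrib_left[symmetric] by (intro sum.cong refl) (simp add: QP)
  also have "\<dots> = (\<Sum>b'\<in>B'. a' b' b')"
    using B'(1) by (simp add: if_distrib cong: if_cong)
  finally show ?thesis .
qed

end

text \<open>\<open>trace_on\<close> is a definite description over all bases: the eigenbasis gives
  existence, basis independence gives uniqueness.\<close>

lemma trace_on_eigenbasis:
  assumes "finite B" "tvs.independent B" "tvs.span B = W"
    and "\<And>b. b \<in> B \<Longrightarrow> f b = cscale (e b) b"
    and add: "\<And>v w. f (v + w) = f v + f w" and scale: "\<And>c v. f (cscale c v) = cscale c (f v)"
  shows "trace_on W f = (\<Sum>b\<in>B. e b)"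
proof -
  define a where "a = (\<lambda>b c. if b = c then e b else 0)"
  have a: "f b = (\<Sum>c\<in>B. cscale (a b c) c)" if "b \<in> B" for b
  proof -
    have "(\<Sum>c\<in>B. cscale (a b c) c) = (\<Sum>c\<in>B. if b = c then cscale (e b) c else 0)"
      unfolding a_def by (intro sum.cong refl) (simp add: cscale_def fun_eq_iff)
    then show ?thesis using assms(1,4) that by simp
  qed
  show ?thesis
    unfolding trace_on_def
  proof (rule the_equality)
    show "\<exists>C a. finite C \<and> C \<subseteq> W \<and> tvs.independent C \<and> tvs.span C = W
       \<and> (\<forall>b\<in>C. f b = (\<Sum>c\<in>C. cscale (a b c) c)) \<and> (\<Sum>b\<in>B. e b) = (\<Sum>b\<in>C. a b b)"
      using assms(1-3) tvs.span_superset[of B] a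
      by (intro exI[of _ B] exI[of _ a]) (auto simp: a_def)
  next
    fix tr
    assume "\<exists>B a. finite B \<and> B \<subseteq> W \<and> tvs.independent B \<and> tvs.span B = W
       \<and> (\<forall>b\<in>B. f b = (\<Sum>c\<in>B. cscale (a b c) c)) \<and> tr = (\<Sum>b\<in>B. a b b)"
    then obtain B' a' where B': "finite B'" "tvs.independent B'" "tvs.span B' = W"
      "\<And>b. b \<in> B' \<Longrightarrow> f b = (\<Sum>c\<in>B'. cscale (a' b c) c)" and tr: "tr = (\<Sum>b\<in>B'. a' b b)"
      by blast
    have "tr = (\<Sum>b\<in>B. a b b)"
      unfolding tr using tvs.trace_basis_independent[OF B'(1,2) assms(1,2) _ add scale B'(4) a] B'(3) assms(3)
      by simp
    then show "tr = (\<Sum>b\<in>B. e b)" by (simp add: a_def)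
  qed
qed

section \<open>The basis of brackets and its weights\<close>

definition wt :: "(nat \<Rightarrow> complex) \<Rightarrow> letter list \<Rightarrow> complex" where
  "wt x w = (\<Prod>a\<leftarrow>w. x (snd a))"

lemma wt_mset:
  assumes "mset u = mset v"
  shows "wt x u = wt x v"
proof -
  have "wt x w = prod_mset (image_mset (\<lambda>a. x (snd a)) (mset w))" for w
    unfolding wt_def by (simp flip: mset_map add: prod_mset_prod_list)
  with assms show ?thesis by simp
qed

definition super_lyndon_words :: "nat \<Rightarrow> nat \<Rightarrow> nat \<Rightarrow> letter list set" where
  "super_lyndon_words N n m = {w \<in> words N n m. super_lyndon w}"

definition lie_basis :: "letter list \<Rightarrow> tensor" where
  "lie_basis w = beval (SOME t. leading_tree t w)"

lemma lie_basis_leading: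
  assumes "super_lyndon w"
  shows "lie_basis w w \<noteq> 0" "lie_basis w z \<noteq> 0 \<Longrightarrow> w \<le> z \<and> mset z = mset w"
  unfolding lie_basis_def
  by (fact leading_treeD(2)[OF someI_ex[OF super_lyndon_leading_tree[OF assms]]],
      fact leading_treeD(3)[OF someI_ex[OF super_lyndon_leading_tree[OF assms]]])

lemma lie_basis_in_freeLie:
  assumes "w \<in> super_lyndon_words N n m"
  shows "lie_basis w \<in> freeLie N n m"
proof -
  have w: "super_lyndon w" "w \<in> words N n m"
    using assms by (auto simp: super_lyndon_words_def)
  note leaves = leading_treeD(1)[OF someI_ex[OF super_lyndon_leading_tree[OF w(1)]]]
  show ?thesis
    unfolding freeLie_def lie_basis_def
  proof (rule tvs.span_base, rule CollectI, intro exI conjI, rule refl)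
    show "\<forall>(p, v)\<in>set (leaves (SOME t. leading_tree t w)). v \<in> Vpart N p"
      unfolding leaves using w(2) by (auto simp: words_def Vpart_def unit_tensor_def)
  qed (use w(2) in \<open>auto simp: leaves words_def filter_map comp_def\<close>)
qed

lemma sum_tensor_apply: "(\<Sum>b\<in>A. F b :: tensor) w = (\<Sum>b\<in>A. F b w)"
  by (induction A rule: infinite_finite_induct) auto

lemma inj_on_lie_basis: "inj_on lie_basis (super_lyndon_words N n m)"
proof (rule inj_onI)
  fix u v assume uv: "u \<in> super_lyndon_words N n m" "v \<in> super_lyndon_words N n m"
    "lie_basis u = lie_basis v"
  then have sl: "super_lyndon u" "super_lyndon v" by (auto simp: super_lyndon_words_def)
  have "u \<le> v" using lie_basis_leading(2)[OF sl(1), of v] lie_basis_leading(1)[OF sl(2)] uv(3) by simp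
  moreover have "v \<le> u" using lie_basis_leading(2)[OF sl(2), of u] lie_basis_leading(1)[OF sl(1)] uv(3) by simp
  ultimately show "u = v" by simp
qed

lemma finite_super_lyndon_words [simp]: "finite (super_lyndon_words N n m)"
  by (simp add: super_lyndon_words_def)

lemma independent_lie_basis: "tvs.independent (lie_basis ` super_lyndon_words N n m)"
proof
  let ?S = "super_lyndon_words N n m"
  assume "tvs.dependent (lie_basis ` ?S)"
  then obtain u where u: "\<exists>v\<in>lie_basis ` ?S. u v \<noteq> 0" "(\<Sum>v\<in>lie_basis ` ?S. cscale (u v) v) = 0"
    using tvs.dependent_finite[of "lie_basis ` ?S"] by auto
  define D where "D = {w \<in> ?S. u (lie_basis w) \<noteq> 0}"
  have "finite D" "D \<noteq> {}" using u(1) by (auto simp: D_def)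
  define w where "w = Min D"
  have w: "w \<in> D" using Min_in[OF \<open>finite D\<close> \<open>D \<noteq> {}\<close>] by (simp add: w_def)
  have least: "w \<le> z" if "z \<in> D" for z using Min_le[OF \<open>finite D\<close> that] by (simp add: w_def)
  \<comment> \<open>The relation is evaluated at the least word that carries a nonzero coefficient;
    brackets with larger leading words vanish there.\<close>
  have "0 = (\<Sum>v\<in>lie_basis ` ?S. cscale (u v) v) w" using u(2) by simp
  also have "\<dots> = (\<Sum>z\<in>?S. u (lie_basis z) * lie_basis z w)"
    by (simp add: sum_tensor_apply sum.reindex[OF inj_on_lie_basis] cscale_def)
  also have "\<dots> = (\<Sum>z\<in>?S. if z = w then u (lie_basis w) * lie_basis w w else 0)"
  proof (intro sum.cong refl)
    fix z assume z: "z \<in> ?S"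
    then have "super_lyndon z" by (simp add: super_lyndon_words_def)
    then have "u (lie_basis z) * lie_basis z w = 0" if "z \<noteq> w"
      using least[of z] lie_basis_leading(2)[of z w] that z unfolding D_def by fastforce
    then show "u (lie_basis z) * lie_basis z w = (if z = w then u (lie_basis w) * lie_basis w w else 0)"
      by simp
  qed
  also have "\<dots> = u (lie_basis w) * lie_basis w w" using w by (simp add: D_def)
  finally show False
    using w lie_basis_leading(1)[of w] by (simp add: D_def super_lyndon_words_def)
qed

lemma span_lie_basis:
  assumes "n + m > 0"
  shows "tvs.span (lie_basis ` super_lyndon_words N n m) = freeLie N n m"
proof
  let ?S = "super_lyndon_words N n m"
  have subspace: "tvs.subspace (freeLie N n m)" by (simp add: freeLie_def)
  show sub: "tvs.span (lie_basis ` ?S) \<subseteq> freeLie N n m"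
    using lie_basis_in_freeLie subspace by (intro tvs.span_minimal) auto
  show "freeLie N n m \<subseteq> tvs.span (lie_basis ` ?S)"
  proof
    fix f assume f: "f \<in> freeLie N n m"
    \<comment> \<open>Triangular interpolation: words are added in increasing order, and the
      correction by \<open>lie_basis b\<close> leaves the values at smaller words unchanged.\<close>
    have "\<exists>g\<in>tvs.span (lie_basis ` ?S). \<forall>w\<in>A. g w = f w" if "finite A" "A \<subseteq> ?S" for A
      using that
    proof (induction A rule: finite_linorder_max_induct)
      case empty
      then show ?case using tvs.span_zero by blast
    next
      case (insert b A)
      then obtain g where g: "g \<in> tvs.span (lie_basis ` ?S)" "\<forall>w\<in>A. g w = f w" by auto
      have b: "b \<in> ?S" "super_lyndon b" using insert.prems by (auto simp: super_lyndon_words_def)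
      define h where "h = g + cscale ((f b - g b) / lie_basis b b) (lie_basis b)"
      have "h \<in> tvs.span (lie_basis ` ?S)"
        unfolding h_def
        by (rule tvs.span_add[OF g(1) tvs.span_scale[OF tvs.span_base[OF imageI[OF b(1)]]]])
      moreover have "h w = f w" if "w \<in> insert b A" for w
      proof (cases "w = b")
        case True
        then show ?thesis using lie_basis_leading(1)[OF b(2)] by (simp add: h_def cscale_def)
      next
        case False
        then have "w < b" using insert.hyps that by blast
        then have "lie_basis b w = 0"
          using lie_basis_leading(2)[OF b(2), of w] leD by blast
        then show ?thesis using False that g(2) by (simp add: h_def cscale_def)
      qed
      ultimately show ?case by blast
    qed
    from this[of ?S] obtain g where g: "g \<in> tvs.span (lie_basis ` ?S)" "\<forall>w\<in>?S. g w = f w" by auto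
    have "f - g \<in> freeLie N n m"
      by (rule tvs.subspace_diff[OF subspace f subsetD[OF sub g(1)]])
    from subsetD[OF freeLie_subset this]
    have fg: "f - g \<in> shuffle_orthogonal" "\<And>w. (f - g) w \<noteq> 0 \<Longrightarrow> w \<in> words N n m"
      by simp_all
    have "f - g = (\<lambda>w. 0)"
    proof (rule shuffle_orthogonal_eq_0[OF fg(1)])
      show "finite {w. (f - g) w \<noteq> 0}"
        by (rule finite_subset[OF _ finite_words[of N n m]]) (use fg(2) in blast)
      have "[] \<notin> words N n m" using length_words[of "[]" N n m] assms by auto
      then show "(f - g) [] = 0" using fg(2)[of "[]"] by blast
      show "(f - g) w = 0" if "super_lyndon w" for w
        using fg(2)[of w] g(2) that by (cases "w \<in> words N n m") (auto simp: super_lyndon_words_def)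
    qed
    from fun_cong[OF this] have "f w = g w" for w by simp
    then have "f = g" by (rule ext)
    then show "f \<in> tvs.span (lie_basis ` ?S)" using g(1) by simp
  qed
qed

lemma character_eq_sum_super_lyndon:
  assumes "n + m > 0"
  shows "character N n m x = (\<Sum>w\<in>super_lyndon_words N n m. wt x w)"
proof -
  let ?S = "super_lyndon_words N n m"
  define e where "e = (\<lambda>b. wt x (the_inv_into ?S lie_basis b))"
  have e: "e (lie_basis w) = wt x w" if "w \<in> ?S" for w
    unfolding e_def by (simp add: the_inv_into_f_f[OF inj_on_lie_basis that])
  have eigen: "diag_act x (lie_basis w) = cscale (wt x w) (lie_basis w)" if "w \<in> ?S" for w
  proof
    fix z
    have w: "super_lyndon w" using that by (simp add: super_lyndon_words_def)
    have act: "diag_act x (lie_basis w) z = wt x z * lie_basis w z"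
      by (simp add: diag_act_def wt_def)
    show "diag_act x (lie_basis w) z = cscale (wt x w) (lie_basis w) z"
    proof (cases "lie_basis w z = 0")
      case False
      then have "mset z = mset w" using lie_basis_leading(2)[OF w] by blast
      from wt_mset[OF this] show ?thesis unfolding act by (simp only: cscale_def)
    qed (simp add: act cscale_def)
  qed
  have "character N n m x = (\<Sum>b\<in>lie_basis ` ?S. e b)"
    unfolding character_def
  proof (rule trace_on_eigenbasis)
    fix b assume "b \<in> lie_basis ` ?S"
    then obtain w where "w \<in> ?S" "b = lie_basis w" by blast
    then show "diag_act x b = cscale (e b) b" by (simp only: eigen e)
  next
    show "diag_act x (v + w) = diag_act x v + diag_act x w" for v w
      by (rule ext) (simp add: diag_act_def distrib_left)
    show "diag_act x (cscale c v) = cscale c (diag_act x v)" for c v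
      by (rule ext) (simp add: diag_act_def cscale_def)
  qed (simp_all add: independent_lie_basis span_lie_basis[OF assms])
  then show ?thesis by (simp add: sum.reindex[OF inj_on_lie_basis] e)
qed

section \<open>Counting Lyndon words\<close>

lemma wpow_mono_same_length:
  fixes a b :: "'a::linorder list"
  assumes "a < b" "length a = length b" "e > 0"
  shows "wpow a e < wpow b e"
  using assms append_less_append_same_length by (cases e) auto

lemma wpow_append_swap: "a @ wpow (b @ a) e = wpow (a @ b) e @ a"
  by (induction e) auto

lemma rotate1_wpow: "rotate1 (wpow l e) = wpow (rotate1 l) e"
proof (cases l; cases e)
  fix c t k assume "l = c # t" "e = Suc k"
  then show ?thesis using wpow_append_swap[of "[c]" k t] by simp
qed simp_all

lemma rotate_wpow: "rotate i (wpow l e) = wpow (rotate i l) e"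
  by (induction i) (auto simp: rotate1_wpow)

lemma length_wpow: "length (wpow l e) = e * length l"
  by (induction e) auto

lemma lyndon_less_rotate:
  assumes "lyndon l" "0 < i" "i < length l"
  shows "l < rotate i l"
proof -
  have "l \<noteq> []" using assms(1) by (simp add: lyndon_def)
  then show ?thesis
    using lyndon_append_less[of "take i l" "drop i l" "[]" "take i l"] assms
    by (simp add: rotate_drop_take)
qed

lemma lyndon_le_rotate:
  assumes "lyndon l"
  shows "l \<le> rotate i l"
proof (cases "i mod length l = 0")
  case True
  then show ?thesis by (metis order_refl rotate0 id_apply rotate_conv_mod)
next
  case False
  moreover have "l \<noteq> []" using assms by (simp add: lyndon_def)
  ultimately show ?thesis
    using lyndon_less_rotate[OF assms, of "i mod length l"] rotate_conv_mod[of i l] by simp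
qed

lemma lyndon_rotate_inj:
  assumes "lyndon l" "rotate i l = rotate j l" "i < length l" "j < length l"
  shows "i = j"
proof -
  have aux: False if "i < j" "rotate i l = rotate j l" "j < length l" for i j
  proof -
    have "rotate (length l - i) (rotate i l) = rotate (length l - i) (rotate j l)" using that(2) by simp
    moreover have "length l - i + i = length l" "length l - i + j = length l + (j - i)" using that by simp_all
    ultimately have "l = rotate (length l + (j - i)) l" by (simp add: rotate_rotate del: add_diff_assoc)
    also have "\<dots> = rotate (j - i) l" by (metis mod_add_self1 rotate_conv_mod)
    finally have "l = rotate (j - i) l" .
    moreover have "l < rotate (j - i) l" using that by (intro lyndon_less_rotate[OF assms(1)]) auto
    ultimately show False by (metis less_irrefl)
  qed
  show ?thesis using aux[of i j] aux[of j i] assms by (metis linorder_neqE_nat)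
qed

lemma lyndon_wpow_le_rotate:
  assumes "lyndon l" "e > 0"
  shows "wpow l e \<le> rotate i (wpow l e)"
proof (cases "l = rotate i l")
  case True
  then show ?thesis by (metis order_refl rotate_wpow)
next
  case False
  with lyndon_le_rotate[OF assms(1), of i] have "l < rotate i l" by simp
  from wpow_mono_same_length[OF this _ assms(2)] show ?thesis by (simp add: rotate_wpow)
qed

text \<open>If the roots had different lengths, the shorter would be both a prefix and a proper
  suffix of the longer. A prefix is not larger, but a proper suffix of a Lyndon word is.\<close>

lemma lyndon_wpow_eqD:
  assumes "lyndon l" "lyndon l'" "e > 0" "e' > 0" "wpow l e = wpow l' e'"
  shows "l = l' \<and> e = e'"
proof -
  have aux: "length l' \<le> length l"
    if prems: "lyndon l" "lyndon l'" "e > 0" "e' > 0" "wpow l e = wpow l' e'" for l l' :: "'a list" and e e'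
  proof (rule ccontr)
    assume "\<not> length l' \<le> length l"
    then have lt: "length l < length l'" by simp
    obtain k k' where k: "e = Suc k" "e' = Suc k'" using prems(3,4) gr0_implies_Suc by metis
    have "wpow l e = wpow l k @ l" "wpow l' e' = wpow l' k' @ l'"
      using k wpow_append_swap[of l k "[]"] wpow_append_swap[of l' k' "[]"] by simp_all
    then have "suffix l l'"
      using lt prems(5) by (metis suffixI suffix_length_suffix less_imp_le)
    then obtain s where s: "l' = s @ l" by (auto simp: suffix_def)
    then have "l' < l" using lyndonD[of s l] prems(1,2) lt by (auto simp: lyndon_def)
    have "wpow l e = l @ wpow l k" "wpow l' e' = l' @ wpow l' k'" using k by auto
    then have "prefix l l'"
      using lt prems(5) by (metis prefixI prefix_length_prefix less_imp_le)
    with \<open>l' < l\<close> prefix_imp_le show False by fastforce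
  qed
  have "length l = length l'"
    using aux[OF assms] aux[OF assms(2,1,4,3) assms(5)[symmetric]] by simp
  moreover obtain k k' where k: "e = Suc k" "e' = Suc k'" using assms(3,4) gr0_implies_Suc by metis
  ultimately have "l = l'" using assms(5) by simp
  moreover have "l \<noteq> []" using assms(1) by (simp add: lyndon_def)
  ultimately show ?thesis
    using arg_cong[OF assms(5), of length] by (simp add: length_wpow)
qed

text \<open>Each of the two powers is the least word of the common rotation class, so they
  coincide.\<close>

lemma rotate_lyndon_wpow_inj:
  assumes "lyndon l" "lyndon l'" "e > 0" "e' > 0" "i < length l" "i' < length l'"
    and eq: "rotate i (wpow l e) = rotate i' (wpow l' e')"
  shows "l = l' \<and> e = e' \<and> i = i'"
proof -
  have unrotate: "\<exists>j. u = rotate j v" if "rotate i u = rotate i' v" for u v :: "'a list" and i i'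
  proof -
    have "u = rotate (length u - i mod length u) (rotate (i mod length u) u)"
      by (cases "u = []") (simp_all add: rotate_rotate less_imp_le)
    also have "rotate (i mod length u) u = rotate i u" by (rule rotate_conv_mod[symmetric])
    also have "\<dots> = rotate i' v" by (fact that)
    finally show ?thesis unfolding rotate_rotate by blast
  qed
  obtain j where j: "wpow l e = rotate j (wpow l' e')" using unrotate[OF eq] by blast
  obtain j' where j': "wpow l' e' = rotate j' (wpow l e)" using unrotate[OF eq[symmetric]] by blast
  have "wpow l e = wpow l' e'"
    using lyndon_wpow_le_rotate[OF assms(1,3), of j'] lyndon_wpow_le_rotate[OF assms(2,4), of j]
    unfolding j[symmetric] j'[symmetric] by (rule order_antisym)
  then have same: "l = l'" "e = e'" using lyndon_wpow_eqD[OF assms(1-4)] by blast+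
  obtain k where "e = Suc k" using assms(3) gr0_implies_Suc by blast
  moreover have "wpow (rotate i l) e = wpow (rotate i' l) e" using eq same by (simp only: rotate_wpow)
  ultimately have "rotate i l = rotate i' l" by simp
  from lyndon_rotate_inj[OF assms(1) this assms(5)] assms(6) same show ?thesis by blast
qed

text \<open>If a proper suffix \<open>v\<close> lies below \<open>l\<close>, comparing
  \<open>v @ u\<close> with \<open>l\<close> forces \<open>l = v @ t\<close> with
  \<open>t < u\<close> of equal length; the rotation \<open>t @ v\<close> is then below
  \<open>l\<close>.\<close>

lemma lyndon_if_less_rotations:
  assumes "l \<noteq> []" "\<And>u v. l = u @ v \<Longrightarrow> u \<noteq> [] \<Longrightarrow> v \<noteq> [] \<Longrightarrow> u @ v < v @ u"
  shows "lyndon l"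
  unfolding lyndon_def
proof (intro conjI allI impI)
  fix u v assume l: "l = u @ v" "u \<noteq> []" "v \<noteq> []"
  have less: "u @ v < v @ u" using assms(2) l by blast
  show "l < v"
  proof (rule ccontr)
    assume "\<not> l < v"
    moreover have "l \<noteq> v" using l by simp
    ultimately have "v < l" by simp
    show False
    proof (cases "prefix v l")
      case False
      from append_less_append[OF \<open>v < l\<close> this, of u "[]"] less l(1) show False by simp
    next
      case True
      then obtain t where t: "l = v @ t" by (auto simp: prefix_def)
      then have "t \<noteq> []" using \<open>v < l\<close> by auto
      have "length t = length u" using t l(1) by (metis add_left_cancel add.commute length_append)
      have "t < u" using less t l(1) by simp
      have "v @ t < t @ v" using assms(2)[OF t l(3) \<open>t \<noteq> []\<close>] .
      then have "u @ v < t @ v" using t l(1) by simp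
      with append_less_append_same_length[OF \<open>t < u\<close> \<open>length t = length u\<close>, of v v]
      show False by simp
    qed
  qed
qed (fact assms(1))

lemma ex_rotate_lyndon_wpow:
  fixes w :: "'a::linorder list"
  assumes "w \<noteq> []"
  obtains l e i where "lyndon l" "e > 0" "i < length l" "w = rotate i (wpow l e)"
proof -
  define R where "R = (\<lambda>i. rotate i w) ` {..<length w}"
  have R: "finite R" "R \<noteq> {}" using assms by (auto simp: R_def)
  have rot_R: "rotate i w \<in> R" for i
    using assms rotate_conv_mod[of i w] unfolding R_def by auto
  define w' where "w' = Min R"
  obtain j where w': "w' = rotate j w" "j < length w" using Min_in[OF R] by (auto simp: w'_def R_def)
  have least: "w' \<le> rotate i w'" for i
    using Min_le[OF R(1) rot_R[of "i + j"]] w' by (simp add: w'_def rotate_rotate)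
  define P where "P = (\<lambda>l. l \<noteq> [] \<and> (\<exists>e>0. w' = wpow l e))"
  have "P w'" unfolding P_def using assms w' by (auto intro!: exI[of _ 1])
  \<comment> \<open>The shortest root of the least rotation. Minimality of the rotation gives weak
    inequalities; shortness makes them strict.\<close>
  define l where "l = arg_min length P"
  have l: "P l" "\<And>u. P u \<Longrightarrow> length l \<le> length u"
    using arg_min_nat_lemma[of P w' length, OF \<open>P w'\<close>] by (auto simp: l_def)
  then obtain e where e: "e > 0" "w' = wpow l e" by (auto simp: P_def)
  have "lyndon l"
  proof (rule lyndon_if_less_rotations)
    show "l \<noteq> []" using l(1) by (simp add: P_def)
    fix u v assume uv: "l = u @ v" "u \<noteq> []" "v \<noteq> []"
    have rot: "rotate (length u) w' = wpow (v @ u) e"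
      unfolding e(2) rotate_wpow uv(1) rotate_append ..
    have "\<not> v @ u < u @ v"
      using wpow_mono_same_length[of "v @ u" "u @ v" e] least[of "length u"] e uv(1) rot by auto
    moreover have "u @ v \<noteq> v @ u"
    proof
      assume "u @ v = v @ u"
      then obtain p q z where z: "wpow z p = u" "wpow z q = v"
        using comm_append_are_replicate by metis
      have "p > 0" "q > 0" "z \<noteq> []" using z uv(2,3) by (auto intro!: gr0I)
      have lz: "l = wpow z (p + q)" using z uv(1) by (simp add: replicate_add)
      have "w' = wpow z ((p + q) * e)"
      proof -
        have "wpow (wpow z k) e = wpow z (k * e)" for k
          by (induction e) (simp_all add: replicate_add)
        then show ?thesis using e(2) lz by simp
      qed
      then have "P z" using \<open>z \<noteq> []\<close> \<open>p > 0\<close> e(1) unfolding P_def by (intro conjI exI[of _ "(p + q) * e"]) auto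
      then have "length l \<le> length z" by (rule l(2))
      moreover have "length l = (p + q) * length z" by (simp only: lz length_wpow)
      moreover have "length z < (p + q) * length z"
        using \<open>p > 0\<close> \<open>q > 0\<close> \<open>z \<noteq> []\<close> by simp
      ultimately show False by simp
    qed
    ultimately show "u @ v < v @ u" by simp
  qed
  have "l \<noteq> []" using l(1) by (simp add: P_def)
  have "w = rotate (length w - j) w'" using w' by (simp add: rotate_rotate)
  also have "\<dots> = wpow (rotate ((length w - j) mod length l) l) e"
    unfolding e(2) rotate_wpow using rotate_conv_mod by metis
  also have "\<dots> = rotate ((length w - j) mod length l) (wpow l e)" by (simp add: rotate_wpow)
  finally show ?thesis
    using that[OF \<open>lyndon l\<close> e(1), of "(length w - j) mod length l"] \<open>l \<noteq> []\<close> by simp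
qed

definition lyndon_words :: "nat \<Rightarrow> nat \<Rightarrow> nat \<Rightarrow> letter list set" where
  "lyndon_words N n m = {w \<in> words N n m. lyndon w}"

lemma finite_lyndon_words [simp]: "finite (lyndon_words N n m)"
  by (simp add: lyndon_words_def)

lemma wt_append: "wt x (u @ v) = wt x u * wt x v"
  by (simp add: wt_def)

lemma wt_wpow: "wt x (wpow w e) = wt (\<lambda>i. x i ^ e) w"
proof -
  have "wt x (wpow w e) = wt x w ^ e"
    by (induction e) (auto simp: wt_append, simp add: wt_def)
  also have "\<dots> = wt (\<lambda>i. x i ^ e) w"
    by (induction w) (auto simp: wt_def power_mult_distrib)
  finally show ?thesis .
qed

lemma mset_rotate: "mset (rotate i w) = mset w"
  by (metis append_take_drop_id mset_append rotate_drop_take union_commute)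

lemma wt_rotate: "wt x (rotate i w) = wt x w"
  by (rule wt_mset[OF mset_rotate])

lemma wpow_words:
  assumes "e > 0"
  shows "wpow l e \<in> words N n m \<longleftrightarrow> e dvd n \<and> e dvd m \<and> l \<in> words N (n div e) (m div e)"
proof -
  have len: "length (filter P (wpow l e)) = e * length (filter P l)" for P
    by (induction e) auto
  have set: "set (wpow l e) = set l" using assms by (cases e) auto
  show ?thesis unfolding words_def mem_Collect_eq len set using assms by auto
qed

text \<open>The offset ranges below the length of \<open>l\<close>, not of its power, because
  rotating \<open>wpow l e\<close> by \<open>length l\<close> gives the same word.\<close>

lemma bij_betw_rotate_lyndon_wpow:
  assumes "n + m > 0"
  shows "bij_betw (\<lambda>(e, l, i). rotate i (wpow l e))
    (SIGMA e:{e. e dvd gcd n m}. lyndon_words N (n div e) (m div e) \<times> {..<(n + m) div e})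
    (words N n m)"
proof -
  let ?T = "SIGMA e:{e. e dvd gcd n m}. lyndon_words N (n div e) (m div e) \<times> {..<(n + m) div e}"
  have T: "e > 0 \<and> lyndon l \<and> i < length l \<and> wpow l e \<in> words N n m" if "(e, l, i) \<in> ?T" for e l i
  proof -
    have e: "e dvd n" "e dvd m" and l: "l \<in> words N (n div e) (m div e)" "lyndon l"
      and i: "i < (n + m) div e"
      using that by (auto simp: lyndon_words_def)
    have "e > 0"
    proof (rule ccontr)
      assume "\<not> e > 0"
      with e assms show False by simp
    qed
    moreover have "length l = (n + m) div e"
      using length_words[OF l(1)] div_add[OF e] by simp
    ultimately show ?thesis using e l i wpow_words[of e l N n m] by simp
  qed
  show ?thesis
  proof (rule bij_betwI')
    fix s t assume "s \<in> ?T" and "t \<in> ?T"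
    obtain e l i where s: "s = (e, l, i)" by (rule prod_cases3)
    obtain e' l' i' where t: "t = (e', l', i')" by (rule prod_cases3)
    note st = s t \<open>s \<in> ?T\<close>[unfolded s] \<open>t \<in> ?T\<close>[unfolded t]
    show "((case s of (e, l, i) \<Rightarrow> rotate i (wpow l e)) = (case t of (e, l, i) \<Rightarrow> rotate i (wpow l e))) = (s = t)"
      unfolding st(1,2) prod.case prod.inject
      using T[OF st(3)] T[OF st(4)] rotate_lyndon_wpow_inj[of l l' e e' i i'] by blast
  next
    fix s assume "s \<in> ?T"
    obtain e l i where s: "s = (e, l, i)" by (rule prod_cases3)
    from T[OF \<open>s \<in> ?T\<close>[unfolded s]] show "(case s of (e, l, i) \<Rightarrow> rotate i (wpow l e)) \<in> words N n m"
      using mset_words[OF mset_rotate[of i "wpow l e"]] s by simp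
  next
    fix w assume w: "w \<in> words N n m"
    then have "w \<noteq> []" using assms length_words[OF w] by auto
    then obtain l e i where lei: "lyndon l" "e > 0" "i < length l" "w = rotate i (wpow l e)"
      by (rule ex_rotate_lyndon_wpow)
    have "wpow l e \<in> words N n m" using w lei(4) mset_words[OF mset_rotate[of i "wpow l e"]] by simp
    then have e: "e dvd n" "e dvd m" "l \<in> words N (n div e) (m div e)"
      using wpow_words[OF lei(2)] by blast+
    then have "length l = (n + m) div e" using length_words[OF e(3)] div_add[OF e(1,2)] by simp
    then have "(e, l, i) \<in> ?T" using e lei(1,3) by (simp add: lyndon_words_def)
    then show "\<exists>s\<in>?T. w = (case s of (e, l, i) \<Rightarrow> rotate i (wpow l e))"
      using lei(4) by (intro bexI[of _ "(e, l, i)"]) auto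
  qed
qed

lemma sum_words_eq_sum_lyndon:
  assumes "n + m > 0"
  shows "(\<Sum>w\<in>words N n m. wt x w) = (\<Sum>e | e dvd gcd n m.
     of_nat ((n + m) div e) * (\<Sum>l\<in>lyndon_words N (n div e) (m div e). wt (\<lambda>i. x i ^ e) l))"
proof -
  have fin: "finite {e. e dvd gcd n m}" using assms by (intro finite_divisors_nat) auto
  have "(\<Sum>w\<in>words N n m. wt x w) = (\<Sum>(e, l, i)\<in>(SIGMA e:{e. e dvd gcd n m}.
      lyndon_words N (n div e) (m div e) \<times> {..<(n + m) div e}). wt (\<lambda>i. x i ^ e) l)"
    unfolding sum.reindex_bij_betw[OF bij_betw_rotate_lyndon_wpow[OF assms], symmetric]
    by (intro sum.cong refl) (auto simp: wt_rotate wt_wpow)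
  also have "\<dots> = (\<Sum>e | e dvd gcd n m. \<Sum>(l, i)\<in>lyndon_words N (n div e) (m div e) \<times> {..<(n + m) div e}. wt (\<lambda>i. x i ^ e) l)"
    using fin by (subst sum.Sigma) auto
  also have "\<dots> = (\<Sum>e | e dvd gcd n m.
     of_nat ((n + m) div e) * (\<Sum>l\<in>lyndon_words N (n div e) (m div e). wt (\<lambda>i. x i ^ e) l))"
    by (intro sum.cong refl) (simp add: sum.cartesian_product[symmetric] sum_distrib_left)
  finally show ?thesis .
qed

section \<open>Weighted enumeration of all words of a bidegree\<close>

definition cons_words :: "bool \<Rightarrow> nat \<Rightarrow> letter list set \<Rightarrow> letter list set" where
  "cons_words p N A = (\<lambda>(i, w). (p, i) # w) ` ({1..N} \<times> A)"

lemma sum_cons_words: "(\<Sum>w\<in>cons_words p N A. wt x w) = power_sum N 1 x * (\<Sum>w\<in>A. wt x w)"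
proof -
  have "inj_on (\<lambda>(i, w). (p, i) # w) ({1..N} \<times> A)" by (auto simp: inj_on_def)
  then have "(\<Sum>w\<in>cons_words p N A. wt x w) = (\<Sum>(i, w)\<in>{1..N} \<times> A. x i * wt x w)"
    unfolding cons_words_def by (subst sum.reindex) (auto intro!: sum.cong simp: wt_def)
  also have "\<dots> = power_sum N 1 x * (\<Sum>w\<in>A. wt x w)"
    by (simp add: power_sum_def sum_product sum.cartesian_product)
  finally show ?thesis .
qed

lemma cons_words_disjoint: "cons_words False N A \<inter> cons_words True N B = {}"
  by (auto simp: cons_words_def)

lemma finite_cons_words: "finite A \<Longrightarrow> finite (cons_words p N A)"
  by (simp add: cons_words_def)

lemma Cons_words_iff:
  "(p, i) # w \<in> words N n m \<longleftrightarrow> i \<in> {1..N} \<and>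
     (if p then m > 0 \<and> w \<in> words N n (m - 1) else n > 0 \<and> w \<in> words N (n - 1) m)"
  by (auto simp: words_def)

lemma Cons_cons_words_iff: "(q, i) # w \<in> cons_words p N A \<longleftrightarrow> q = p \<and> i \<in> {1..N} \<and> w \<in> A"
  by (auto simp: cons_words_def)

lemma Nil_cons_words: "[] \<notin> cons_words p N A"
  by (auto simp: cons_words_def)

lemma Nil_words: "[] \<in> words N n m \<longleftrightarrow> n = 0 \<and> m = 0"
  by (auto simp: words_def)

lemma words_unfold:
  "words N 0 0 = {[]}"
  "words N (Suc n) 0 = cons_words False N (words N n 0)"
  "words N 0 (Suc m) = cons_words True N (words N 0 m)"
  "words N (Suc n) (Suc m) = cons_words False N (words N n (Suc m)) \<union> cons_words True N (words N (Suc n) m)"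
proof -
  show "words N 0 0 = {[]}" using length_words[of _ N 0 0] by (auto simp: Nil_words)
  have ext: "A = B" if "[] \<in> A \<longleftrightarrow> [] \<in> B" "\<And>p i w. (p, i) # w \<in> A \<longleftrightarrow> (p, i) # w \<in> B"
    for A B :: "letter list set"
  proof (rule set_eqI)
    fix w :: "letter list"
    show "w \<in> A \<longleftrightarrow> w \<in> B"
    proof (cases w)
      case (Cons a u)
      then show ?thesis using that(2)[of "fst a" "snd a" u] by simp
    qed (use that(1) in simp)
  qed
  show "words N (Suc n) 0 = cons_words False N (words N n 0)"
    by (rule ext) (auto simp: Nil_words Nil_cons_words Cons_words_iff Cons_cons_words_iff)
  show "words N 0 (Suc m) = cons_words True N (words N 0 m)"
    by (rule ext) (auto simp: Nil_words Nil_cons_words Cons_words_iff Cons_cons_words_iff)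
  show "words N (Suc n) (Suc m) = cons_words False N (words N n (Suc m)) \<union> cons_words True N (words N (Suc n) m)"
    by (rule ext) (auto simp: Nil_words Nil_cons_words Cons_words_iff Cons_cons_words_iff)
qed

lemma sum_words:
  "(\<Sum>w\<in>words N n m. wt x w) = of_nat ((n + m) choose m) * power_sum N 1 x ^ (n + m)"
proof (induction "n + m" arbitrary: n m)
  case 0
  then show ?case by (simp add: words_unfold wt_def)
next
  case (Suc k)
  show ?case
  proof (cases n; cases m)
    fix n' assume "n = Suc n'" "m = 0"
    then show ?thesis using Suc(1)[of n' 0] Suc(2) by (simp add: words_unfold sum_cons_words)
  next
    fix m' assume "n = 0" "m = Suc m'"
    then show ?thesis using Suc(1)[of 0 m'] Suc(2) by (simp add: words_unfold sum_cons_words)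
  next
    fix n' m' assume nm: "n = Suc n'" "m = Suc m'"
    have "(\<Sum>w\<in>words N n m. wt x w)
        = power_sum N 1 x * (\<Sum>w\<in>words N n' (Suc m'). wt x w) + power_sum N 1 x * (\<Sum>w\<in>words N (Suc n') m'. wt x w)"
      unfolding nm words_unfold
      by (subst sum.union_disjoint) (auto simp: finite_cons_words cons_words_disjoint sum_cons_words)
    also have "\<dots> = of_nat ((n + m) choose m) * power_sum N 1 x ^ (n + m)"
      using Suc(1)[of n' "Suc m'"] Suc(1)[of "Suc n'" m'] Suc(2) nm by (simp add: algebra_simps)
    finally show ?thesis .
  qed (use Suc(2) in simp)
qed

lemma power_sum_power: "power_sum N d (\<lambda>i. x i ^ e) = power_sum N (e * d) x"
  by (simp add: power_sum_def power_mult)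

section \<open>Moebius inversion\<close>

lemma moebius_mult_prime:
  assumes "prime p" "\<not> p dvd d"
  shows "moebius (p * d) = - moebius d"
proof -
  have "d > 0" using assms(2) by (auto intro!: gr0I)
  have "coprime p d" using assms by (simp add: prime_imp_coprime)
  then have sq: "squarefree (p * d) \<longleftrightarrow> squarefree d"
    using squarefree_mult_coprime[of p d] squarefree_prime[OF assms(1)] squarefree_multD(2) by blast
  have "prime_factors (p * d) = insert p (prime_factors d)"
    using assms \<open>d > 0\<close> by (subst prime_factors_product) (auto simp: prime_prime_factors)
  moreover have "p \<notin> prime_factors d" using assms(2) by auto
  ultimately show ?thesis
    using sq \<open>d > 0\<close> assms(1) by (auto simp: moebius_def dest: prime_gt_0_nat)
qed

lemma moebius_square:
  assumes "prime p" "p ^ 2 dvd d"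
  shows "moebius d = 0"
  using assms by (auto simp: moebius_def squarefree_def)

lemma sum_moebius:
  assumes "c > 0"
  shows "(\<Sum>d | d dvd c. moebius d) = (if c = 1 then 1 else 0)"
proof (cases "c = 1")
  case True
  then show ?thesis by (simp add: moebius_def)
next
  case False
  then obtain p where p: "prime p" "p dvd c" using prime_factor_nat by blast
  \<comment> \<open>Divisors are sorted by their exponent of \<open>p\<close>: 0, 1, or at least 2.
    The first two classes cancel under multiplication by \<open>p\<close>, and on the third the
    Moebius function is 0.\<close>
  define D0 where "D0 = {d. d dvd c \<and> \<not> p dvd d}"
  define D2 where "D2 = {d. d dvd c \<and> p ^ 2 dvd d}"
  have fin: "finite {d. d dvd c}" using assms by simp
  then have fin': "finite D0" "finite D2" by (auto simp: D0_def D2_def)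
  have "p > 0" using p(1) by (rule prime_gt_0_nat)
  have split: "{d. d dvd c} = (D0 \<union> (*) p ` D0) \<union> D2"
  proof (intro equalityI subsetI)
    fix d assume d: "d \<in> {d. d dvd c}"
    show "d \<in> (D0 \<union> (*) p ` D0) \<union> D2"
    proof (cases "p dvd d")
      case True
      then obtain b where b: "d = p * b" by blast
      then have "b dvd c" using d by (auto dest: dvd_mult_right)
      then show ?thesis using b d \<open>p > 0\<close> by (cases "p dvd b") (auto simp: D0_def D2_def power2_eq_square)
    qed (use d in \<open>simp add: D0_def\<close>)
  next
    fix d assume "d \<in> (D0 \<union> (*) p ` D0) \<union> D2"
    moreover have "p * b dvd c" if "b \<in> D0" for b
    proof -
      have "coprime p b" using that p(1) by (simp add: D0_def prime_imp_coprime)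
      then show ?thesis using that p(2) by (simp add: D0_def divides_mult)
    qed
    ultimately show "d \<in> {d. d dvd c}" by (auto simp: D0_def D2_def)
  qed
  have "(\<Sum>d | d dvd c. moebius d) = (\<Sum>d\<in>D0 \<union> (*) p ` D0. moebius d) + (\<Sum>d\<in>D2. moebius d)"
  proof -
    have "(D0 \<union> (*) p ` D0) \<inter> D2 = {}"
      using \<open>p > 0\<close> by (auto simp: D0_def D2_def power2_eq_square dest: dvd_mult_left)
    then show ?thesis unfolding split using fin' by (intro sum.union_disjoint) auto
  qed
  also have "(\<Sum>d\<in>D2. moebius d) = 0"
    using moebius_square[OF p(1)] by (intro sum.neutral) (auto simp: D2_def)
  also have "(\<Sum>d\<in>D0 \<union> (*) p ` D0. moebius d) = (\<Sum>d\<in>D0. moebius d) + (\<Sum>d\<in>(*) p ` D0. moebius d)"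
    using fin' by (intro sum.union_disjoint) (auto simp: D0_def)
  also have "(\<Sum>d\<in>(*) p ` D0. moebius d) = (\<Sum>d\<in>D0. moebius (p * d))"
    using \<open>p > 0\<close> by (subst sum.reindex) (auto simp: inj_on_def)
  also have "\<dots> = (\<Sum>d\<in>D0. - moebius d)"
    using moebius_mult_prime[OF p(1)] by (intro sum.cong refl) (auto simp: D0_def)
  finally show ?thesis using False by (simp add: sum_negf)
qed

lemma dvd_div_pos_nat:
  fixes a d :: nat
  shows "d dvd a \<Longrightarrow> a > 0 \<Longrightarrow> a div d > 0"
  by (auto elim!: dvdE)

text \<open>Stated for a function of the divisor, because passing from 1 to c changes both degrees
  and the variables at once. The double sum is regrouped by c = d * e.\<close>

lemma moebius_inversion:
  fixes H :: "nat \<Rightarrow> complex"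
  assumes "g > 0"
  shows "(\<Sum>d | d dvd g. of_int (moebius d) * (\<Sum>e | e dvd g div d. H (d * e))) = H 1"
proof -
  have pos: "d > 0" if "d dvd g" for d using that assms by (rule dvd_pos_nat[rotated])
  have fin: "finite {d. d dvd a}" if "a > 0" for a :: nat using that by simp
  have "(\<Sum>d | d dvd g. of_int (moebius d) * (\<Sum>e | e dvd g div d. H (d * e)))
      = (\<Sum>(d, e)\<in>(SIGMA d:{d. d dvd g}. {e. e dvd g div d}). of_int (moebius d) * H (d * e))"
    unfolding sum_distrib_left using assms pos
    by (intro sum.Sigma) (auto intro!: fin dvd_div_pos_nat)
  also have "\<dots> = (\<Sum>(c, d)\<in>(SIGMA c:{c. c dvd g}. {d. d dvd c}). of_int (moebius d) * H c)"
  proof (rule sum.reindex_bij_witness[of _ "\<lambda>(c, d). (d, c div d)" "\<lambda>(d, e). (d * e, d)"], goal_cases)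
    case (1 a)
    then show ?case using pos by auto
  next
    case (2 a)
    then show ?case using assms by (auto simp: dvd_div_iff_mult mult.commute)
  next
    case (3 a)
    then show ?case by auto
  next
    case (4 a)
    then show ?case using pos by (auto intro: dvd_trans div_dvd_div[THEN iffD2])
  next
    case (5 a)
    then show ?case by auto
  qed
  also have "\<dots> = (\<Sum>c | c dvd g. \<Sum>d | d dvd c. of_int (moebius d) * H c)"
    using assms pos by (intro sum.Sigma[symmetric]) (auto intro!: fin)
  also have "\<dots> = (\<Sum>c | c dvd g. of_int (\<Sum>d | d dvd c. moebius d) * H c)"
    by (simp add: sum_distrib_right)
  also have "\<dots> = (\<Sum>c | c dvd g. if c = 1 then H 1 else 0)"
    using pos by (intro sum.cong refl) (auto simp: sum_moebius)
  also have "\<dots> = H 1" using assms by simp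
  finally show ?thesis .
qed

text \<open>The summand of the Witt formula for ordinary Lyndon words, that is, without the super
  sign.\<close>

definition witt_term :: "nat \<Rightarrow> nat \<Rightarrow> nat \<Rightarrow> (nat \<Rightarrow> complex) \<Rightarrow> nat \<Rightarrow> complex" where
  "witt_term N n m x d = of_int (moebius d) * of_nat (((n + m) div d) choose (m div d))
     * power_sum N d x ^ ((n + m) div d)"

lemma sum_lyndon_words:
  assumes "n + m > 0"
  shows "of_nat (n + m) * (\<Sum>l\<in>lyndon_words N n m. wt x l) = (\<Sum>d | d dvd gcd n m. witt_term N n m x d)"
proof -
  \<comment> \<open>\<open>H c\<close> counts the words whose Lyndon root occurs c times. In
    bidegree (n/d, m/d) and variables x^d, the total count of words becomes the sum of
    \<open>H (d * e)\<close> over e.\<close>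
  define H where "H = (\<lambda>c. of_nat ((n + m) div c) *
    (\<Sum>l\<in>lyndon_words N (n div c) (m div c). wt (\<lambda>i. x i ^ c) l))"
  have "witt_term N n m x d = of_int (moebius d) * (\<Sum>e | e dvd gcd n m div d. H (d * e))"
    if d: "d dvd gcd n m" for d
  proof -
    have dn: "d dvd n" "d dvd m" using d by auto
    then have pos: "d > 0" using assms by (auto intro!: gr0I)
    have k: "(n + m) div d = n div d + m div d" using dn by (rule div_add)
    have kpos: "n div d + m div d > 0"
      using assms dvd_div_pos_nat[OF dn(1)] dvd_div_pos_nat[OF dn(2)] by auto
    have g: "gcd n m div d = gcd (n div d) (m div d)"
    proof -
      obtain a b where ab: "n = d * a" "m = d * b" using dn by blast
      have "gcd n m = d * gcd a b" unfolding ab by (rule gcd_mult_distrib_nat[symmetric])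
      then show ?thesis using ab pos by simp
    qed
    have "of_nat (((n + m) div d) choose (m div d)) * power_sum N d x ^ ((n + m) div d)
        = (\<Sum>w\<in>words N (n div d) (m div d). wt (\<lambda>i. x i ^ d) w)"
      unfolding sum_words k by (simp add: power_sum_power)
    also have "\<dots> = (\<Sum>e | e dvd gcd n m div d. H (d * e))"
      unfolding sum_words_eq_sum_lyndon[OF kpos] g H_def k[symmetric]
      by (simp add: div_mult2_eq power_mult)
    finally show ?thesis by (simp add: witt_term_def)
  qed
  then have "(\<Sum>d | d dvd gcd n m. witt_term N n m x d)
      = (\<Sum>d | d dvd gcd n m. of_int (moebius d) * (\<Sum>e | e dvd gcd n m div d. H (d * e)))"
    by simp
  also have "\<dots> = H 1" using assms by (intro moebius_inversion) auto
  finally show ?thesis by (simp add: H_def)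
qed

section \<open>Odd squares and the signs of the formula\<close>

lemma super_lyndon_words_eq:
  "super_lyndon_words N n m = lyndon_words N n m \<union>
    (if even n \<and> even m \<and> odd (m div 2) then (\<lambda>l. l @ l) ` lyndon_words N (n div 2) (m div 2) else {})"
proof -
  have sq: "l @ l \<in> words N n m \<longleftrightarrow> even n \<and> even m \<and> l \<in> words N (n div 2) (m div 2)" for l
    using wpow_words[of 2 l N n m] by (simp add: numeral_2_eq_2)
  have par: "opar l \<longleftrightarrow> odd (m div 2)" if "l \<in> words N (n div 2) (m div 2)" for l
    using opar_words[OF that] by simp
  show ?thesis
    unfolding super_lyndon_words_def lyndon_words_def super_lyndon_def
    using sq par by auto
qed

lemma sum_super_lyndon_words:
  "(\<Sum>w\<in>super_lyndon_words N n m. wt x w) = (\<Sum>l\<in>lyndon_words N n m. wt x l) +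
    (if even n \<and> even m \<and> odd (m div 2)
     then \<Sum>l\<in>lyndon_words N (n div 2) (m div 2). wt (\<lambda>i. x i ^ 2) l else 0)"
proof (cases "even n \<and> even m \<and> odd (m div 2)")
  case True
  have "\<not> lyndon (l @ l)" for l :: "letter list"
  proof
    assume l: "lyndon (l @ l)"
    then have "l \<noteq> []" by (auto simp: lyndon_def)
    with lyndonD[OF l] have "l @ l < l" by blast
    with leD[OF le_append[of l l]] show False by blast
  qed
  then have disj: "lyndon_words N n m \<inter> (\<lambda>l. l @ l) ` lyndon_words N (n div 2) (m div 2) = {}"
    by (auto simp: lyndon_words_def)
  have "(\<Sum>w\<in>(\<lambda>l. l @ l) ` lyndon_words N (n div 2) (m div 2). wt x w)
      = (\<Sum>l\<in>lyndon_words N (n div 2) (m div 2). wt (\<lambda>i. x i ^ 2) l)"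
  proof (subst sum.reindex)
    show "inj_on (\<lambda>l. l @ l) (lyndon_words N (n div 2) (m div 2))"
    proof (rule inj_onI)
      fix u v :: "letter list" assume "u @ u = v @ v"
      moreover from arg_cong[OF this, of length] have "length u = length v" by simp
      ultimately show "u = v" by simp
    qed
    have "wt x (l @ l) = wt (\<lambda>i. x i ^ 2) l" for l
      using wt_wpow[of x 2 l] by (simp add: numeral_2_eq_2)
    then show "sum (wt x \<circ> (\<lambda>l. l @ l)) (lyndon_words N (n div 2) (m div 2))
      = (\<Sum>l\<in>lyndon_words N (n div 2) (m div 2). wt (\<lambda>i. x i ^ 2) l)"
      by simp
  qed
  then show ?thesis
    using True disj by (simp add: super_lyndon_words_eq sum.union_disjoint)
next
  case False
  then have "super_lyndon_words N n m = lyndon_words N n m"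
    by (simp only: super_lyndon_words_eq if_False Un_empty_right)
  with False show ?thesis by (simp only: if_False add_0_right)
qed

lemma even_div_odd_double:
  fixes m d :: nat
  assumes "d dvd m" "even m" "odd (m div d)"
  shows "even d"
  using assms by (metis dvd_mult_div_cancel even_mult_iff)

text \<open>\<open>d\<close> divides the odd number \<open>m div 2\<close>, so \<open>2 * d\<close>
  gains exactly one new prime; this is the origin of the sign.\<close>

lemma witt_term_double:
  assumes "even n" "even m" "odd (m div 2)" "d dvd gcd (n div 2) (m div 2)"
  shows "witt_term N n m x (2 * d) = - witt_term N (n div 2) (m div 2) (\<lambda>i. x i ^ 2) d"
proof -
  have "odd d" using assms(3,4) by (metis dvd_trans gcd_dvd2)
  then have "moebius (2 * d) = - moebius d" by (intro moebius_mult_prime) auto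
  moreover have "(n + m) div (2 * d) = (n div 2 + m div 2) div d"
    using assms(1,2) by (simp add: div_mult2_eq)
  moreover have "m div (2 * d) = m div 2 div d" by (simp add: div_mult2_eq)
  ultimately show ?thesis by (simp add: witt_term_def power_sum_power)
qed

text \<open>An odd quotient of the even \<open>m\<close> puts the full power of 2 in
  \<open>m\<close> into \<open>d\<close>. If that power is 2, then d = 2b and the terms come from
  the halved bidegree, provided n is even. If 4 divides \<open>m\<close>, it divides
  \<open>d\<close> and the Moebius function vanishes.\<close>

lemma sum_witt_term_odd:
  assumes "n + m > 0" "even m"
  shows "(\<Sum>d | d dvd gcd n m \<and> odd (m div d). witt_term N n m x d) =
    (if even n \<and> odd (m div 2)
     then - (\<Sum>d | d dvd gcd (n div 2) (m div 2). witt_term N (n div 2) (m div 2) (\<lambda>i. x i ^ 2) d) else 0)"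
proof (cases "even n \<and> odd (m div 2)")
  case True
  have "{d. d dvd gcd n m \<and> odd (m div d)} = (*) 2 ` {d. d dvd gcd (n div 2) (m div 2)}"
  proof (intro equalityI subsetI)
    fix d assume "d \<in> {d. d dvd gcd n m \<and> odd (m div d)}"
    then have d: "d dvd n" "d dvd m" "odd (m div d)" by auto
    obtain b where b: "d = 2 * b" using even_div_odd_double[OF d(2) assms(2) d(3)] by blast
    have "b dvd n div 2" "b dvd m div 2" using d b True assms(2) by (auto elim!: evenE)
    then show "d \<in> (*) 2 ` {d. d dvd gcd (n div 2) (m div 2)}" using b by auto
  next
    fix d assume "d \<in> (*) 2 ` {d. d dvd gcd (n div 2) (m div 2)}"
    then obtain b where b: "d = 2 * b" "b dvd n div 2" "b dvd m div 2" by auto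
    have "d dvd n" "d dvd m" using b True assms(2) by (auto elim!: evenE)
    moreover have "odd (m div d)"
      using b True by (metis div_mult2_eq dvd_div_mult_self even_mult_iff)
    ultimately show "d \<in> {d. d dvd gcd n m \<and> odd (m div d)}" by auto
  qed
  then show ?thesis
    using True assms(2) by (simp add: sum.reindex inj_on_def witt_term_double sum_negf)
next
  case False
  have "witt_term N n m x d = 0" if d: "d dvd gcd n m" "odd (m div d)" for d
  proof -
    have dd: "d dvd n" "d dvd m" using d(1) by auto
    have "even d" using even_div_odd_double[OF dd(2) assms(2) d(2)] .
    then have "even n" using dd(1) by (rule dvd_trans)
    then have "even (m div 2)" using False by simp
    then have "4 dvd m" using assms(2) by (auto elim!: evenE)
    have "2 ^ 2 dvd d"
    proof (rule ccontr)
      assume n4: "\<not> 2 ^ 2 dvd d"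
      obtain b where b: "d = 2 * b" using \<open>even d\<close> by blast
      have "odd b" using n4 b by (auto simp: power2_eq_square)
      have m: "m = 2 * b * (m div d)" using dd(2) b by simp
      with \<open>4 dvd m\<close> have "2 * 2 dvd 2 * (b * (m div d))" by (simp add: mult.assoc)
      then have "even (b * (m div d))" by (simp only: nat_mult_dvd_cancel_disj) simp
      with \<open>odd b\<close> d(2) show False by simp
    qed
    then show ?thesis using moebius_square[of 2 d] by (simp add: witt_term_def)
  qed
  then have "(\<Sum>d | d dvd gcd n m \<and> odd (m div d). witt_term N n m x d) = 0"
    by (intro sum.neutral) auto
  with False show ?thesis by auto
qed

theorem theorem1p1:
  fixes n m N :: nat and x :: "nat \<Rightarrow> complex"
  assumes "n + m > 0" and "N \<ge> 1"
  shows "character N n m x =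
    (1 / of_nat (n + m)) *
      (\<Sum>d\<in>{d. d dvd gcd n m}.
         (-1) ^ (m + m div d) * of_int (moebius d) * of_nat (((n + m) div d) choose (m div d))
         * power_sum N d x ^ ((n + m) div d))"
proof -
  let ?D = "{d. d dvd gcd n m}"
  let ?E = "{d. d dvd gcd n m \<and> odd (m div d)}"
  let ?k = "of_nat (n + m) :: complex"
  let ?L = "\<Sum>l\<in>lyndon_words N n m. wt x l"
  let ?L2 = "\<Sum>l\<in>lyndon_words N (n div 2) (m div 2). wt (\<lambda>i. x i ^ 2) l"
  have fin: "finite ?D" using assms(1) by auto
  have k: "?k \<noteq> 0" using assms(1) by (simp only: of_nat_eq_0_iff)
  have L: "?k * ?L = (\<Sum>d\<in>?D. witt_term N n m x d)"
    by (rule sum_lyndon_words[OF assms(1)])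
  have "(\<Sum>d\<in>?D. (-1) ^ (m + m div d) * of_int (moebius d) * of_nat (((n + m) div d) choose (m div d))
         * power_sum N d x ^ ((n + m) div d)) = (\<Sum>d\<in>?D. (-1) ^ (m + m div d) * witt_term N n m x d)"
    by (simp add: witt_term_def mult.assoc)
  also have "\<dots> = ?k * (\<Sum>w\<in>super_lyndon_words N n m. wt x w)"
  proof (cases "even m")
    \<comment> \<open>For odd \<open>m\<close> all quotients \<open>m div d\<close> are odd, so
      every sign is +1, and there are no squares.\<close>
    case False
    have "(-1) ^ (m + m div d) * witt_term N n m x d = witt_term N n m x d" if "d \<in> ?D" for d
    proof -
      have "d dvd m" using that by simp
      then have "odd (m div d)" using False by (metis dvd_div_mult_self even_mult_iff)
      then show ?thesis using False by simp
    qed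
    then have "(\<Sum>d\<in>?D. (-1) ^ (m + m div d) * witt_term N n m x d) = ?k * ?L"
      unfolding L by (rule sum.cong[OF refl])
    then show ?thesis using False by (simp add: sum_super_lyndon_words)
  next
    case True
    \<comment> \<open>For even \<open>m\<close> the sign is -1 exactly at odd quotients, which costs
      twice the terms there.\<close>
    have "(\<Sum>d\<in>?D. (-1) ^ (m + m div d) * witt_term N n m x d)
        = (\<Sum>d\<in>?D. witt_term N n m x d - 2 * (if odd (m div d) then witt_term N n m x d else 0))"
      using True by (intro sum.cong refl) auto
    also have "\<dots> = ?k * ?L - 2 * (\<Sum>d\<in>?E. witt_term N n m x d)"
    proof -
      have "?E = {d \<in> ?D. odd (m div d)}" by auto
      then have "(\<Sum>d\<in>?E. witt_term N n m x d) = (\<Sum>d\<in>?D. if odd (m div d) then witt_term N n m x d else 0)"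
        by (simp only: sum.inter_filter[OF fin])
      then show ?thesis by (simp only: L sum_subtractf sum_distrib_left[symmetric])
    qed
    also have "\<dots> = ?k * (?L + (if even n \<and> even m \<and> odd (m div 2) then ?L2 else 0))"
    proof (cases "even n \<and> odd (m div 2)")
      case nm: True
      have pos: "n div 2 + m div 2 > 0" using nm odd_pos[of "m div 2"] by simp
      \<comment> \<open>The inversion formula for \<open>?L2\<close> carries the factor (n + m)/2;
        the 2 missing from \<open>?k\<close> is the 2 of the sign correction.\<close>
      have "?k = 2 * of_nat (n div 2 + m div 2)"
      proof -
        have "n + m = 2 * (n div 2 + m div 2)" using nm True by simp
        from arg_cong[OF this, of of_nat] show ?thesis by (simp only: of_nat_mult of_nat_numeral)
      qed
      then have k2: "?k * ?L2 = 2 * (\<Sum>d | d dvd gcd (n div 2) (m div 2).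
          witt_term N (n div 2) (m div 2) (\<lambda>i. x i ^ 2) d)"
        by (simp only: mult.assoc sum_lyndon_words[OF pos])
      have "even n \<and> even m \<and> odd (m div 2)" using nm True by blast
      then show ?thesis
        by (simp only: sum_witt_term_odd[OF assms(1) True] nm if_True distrib_left k2 simp_thms) simp
    next
      case False
      then have "\<not> (even n \<and> even m \<and> odd (m div 2))" by blast
      with False show ?thesis by (simp only: sum_witt_term_odd[OF assms(1) True] if_False) simp
    qed
    finally show ?thesis by (simp only: sum_super_lyndon_words)
  qed
  finally have sum_eq: "(\<Sum>d\<in>?D. (-1) ^ (m + m div d) * of_int (moebius d)
      * of_nat (((n + m) div d) choose (m div d)) * power_sum N d x ^ ((n + m) div d))
    = ?k * (\<Sum>w\<in>super_lyndon_words N n m. wt x w)" .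
  show ?thesis
    unfolding sum_eq character_eq_sum_super_lyndon[OF assms(1)]
    using k by (simp del: of_nat_add)
qed

end
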